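(* Let $n\ge1$ and $\mu\in(0,2)$. There are constants $C_1,C_2>0$ and $\alpha>0$ depending on $n$ and $\mu$ such that the following holds. Let $u_0\in H^1({\bf R}^n)\cap L^1({\bf R}^n)$ and $u_1\in L^2({\bf R}^n)\cap L^{1,1}({\bf R}^n)$, let $P_1:=\int_{{\bf R}^n}u_1(x)\,dx$, and let $u(t,x)$ be the solution of $$u_{tt}-\Delta u+\mu L u_t=0\ \text{ in }(0,\infty)\times{\bf R}^n,\qquad u(0,x)=u_0(x),\quad u_t(0,x)=u_1(x),\ x\in{\bf R}^n.$$ Then, for all sufficiently large $t$, $$C_1|P_1|\,t^{1-\frac n2}\le\Vert u(t,\cdot)\Vert\le C_2\Big(\Vert u_1\Vert_{1,1}t^{-\frac n2}+\Vert u_0\Vert_1t^{-\frac n2}+|P_1|\,t^{1-\frac n2}+|P_1|e^{-\alpha t}\Big).$$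
   Context: Fourier transform: ${\cal F}_{x\to\xi}(f)(\xi)=\hat f(\xi)=\int_{{\bf R}^n}e^{-ix\cdot\xi}f(x)\,dx$, with inverse ${\cal F}^{-1}_{\xi\to x}$. The operator $L=\log(I+(-\Delta)^{1/2})$ on $L^2({\bf R}^n)$ is the Fourier multiplier $(Lf)(x)={\cal F}^{-1}_{\xi\to x}(\log(1+|\xi|)\hat f(\xi))(x)$ with domain $D(L)=\{f\in L^2:\int(1+\log^2(1+|\xi|))|\hat f(\xi)|^2d\xi<\infty\}$. For $(u_0,u_1)\in H^1({\bf R}^n)\times L^2({\bf R}^n)$ "the solution" is the unique mild solution $u\in C([0,\infty);H^1({\bf R}^n))\cap C^1([0,\infty);L^2({\bf R}^n))$; equivalently, $w(t,\xi)=\hat u(t,\xi)$ (Fourier transform in $x$) solves $w_{tt}+\mu\log(1+|\xi|)w_t+|\xi|^2w=0$, $w(0,\xi)=\hat u_0(\xi)$, $w_t(0,\xi)=\hat u_1(\xi)$. Norms: $\Vert\cdot\Vert_q$ is the $L^q({\bf R}^n)$-norm, $\Vert\cdot\Vert=\Vert\cdot\Vert_2$, and $L^{1,1}({\bf R}^n)=\{f\in L^1:\Vert f\Vert_{1,1}:=\int_{{\bf R}^n}(1+|x|)|f(x)|dx<\infty\}$. "Sufficiently large $t$" means $t\ge t_0$ for some $t_0>0$, which may depend on the data. *)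

theory Defs
  imports "HOL-Analysis.Analysis"
begin

text \<open>
  Elements of \<open>L\<^sup>q\<close> are represented by Borel functions \<open>real ^ 'n \<Rightarrow> complex\<close>; every class modulo
  null sets has such a representative. Real-valued data are the special case of functions with
  real values.
\<close>

definition L1_space :: "((real ^ 'n::finite) \<Rightarrow> complex) set" where
  "L1_space = {f. integrable lborel f}"

definition L1_norm :: "((real ^ 'n::finite) \<Rightarrow> complex) \<Rightarrow> real" where
  "L1_norm f = (\<integral>x. cmod (f x) \<partial>lborel)"

definition L2_space :: "((real ^ 'n::finite) \<Rightarrow> complex) set" where
  "L2_space = {f. f \<in> borel_measurable lborel \<and> integrable lborel (\<lambda>x. (cmod (f x))\<^sup>2)}"

definition L2_norm :: "((real ^ 'n::finite) \<Rightarrow> complex) \<Rightarrow> real" where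
  "L2_norm f = sqrt (\<integral>x. (cmod (f x))\<^sup>2 \<partial>lborel)"

definition L11_space :: "((real ^ 'n::finite) \<Rightarrow> complex) set" where
  "L11_space = {f \<in> L1_space. integrable lborel (\<lambda>x. (1 + norm x) * cmod (f x))}"

definition L11_norm :: "((real ^ 'n::finite) \<Rightarrow> complex) \<Rightarrow> real" where
  "L11_norm f = (\<integral>x. (1 + norm x) * cmod (f x) \<partial>lborel)"

text \<open>
  Convergence in \<open>L\<^sup>2\<close>. The extended integral is used because the Bochner integral
  of a non-integrable function is \<open>0\<close>.
\<close>

definition L2_tendsto ::
    "('b \<Rightarrow> (real ^ 'n::finite) \<Rightarrow> complex) \<Rightarrow> ((real ^ 'n) \<Rightarrow> complex) \<Rightarrow> 'b filter \<Rightarrow> bool" where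
  "L2_tendsto F f \<F> \<longleftrightarrow>
     ((\<lambda>s. \<integral>\<^sup>+x. ennreal ((cmod (F s x - f x))\<^sup>2) \<partial>lborel) \<longlongrightarrow> 0) \<F>"

definition fourier :: "((real ^ 'n::finite) \<Rightarrow> complex) \<Rightarrow> (real ^ 'n) \<Rightarrow> complex" where
  "fourier f \<xi> = (\<integral>x. exp (- (\<i> * complex_of_real (x \<bullet> \<xi>))) * f x \<partial>lborel)"

text \<open>
  The Fourier transform on \<open>L\<^sup>2\<close> (Plancherel): \<open>g\<close> is a version of the transform of \<open>f\<close> if it is
  the \<open>L\<^sup>2\<close>-limit of the transforms of the truncations of \<open>f\<close> to balls, which lie in
  \<open>L\<^sup>1 \<inter> L\<^sup>2\<close>. It is a relation since \<open>g\<close> is determined only up to null sets;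
  \<open>fourier_L2\<close> picks one version.
\<close>

definition has_fourier_L2 ::
    "((real ^ 'n::finite) \<Rightarrow> complex) \<Rightarrow> ((real ^ 'n) \<Rightarrow> complex) \<Rightarrow> bool" where
  "has_fourier_L2 f g \<longleftrightarrow> f \<in> L2_space \<and> g \<in> L2_space \<and>
     L2_tendsto (\<lambda>R::real. fourier (\<lambda>x. indicator (cball 0 R) x * f x)) g at_top"

definition fourier_L2 :: "((real ^ 'n::finite) \<Rightarrow> complex) \<Rightarrow> (real ^ 'n) \<Rightarrow> complex" where
  "fourier_L2 f = (SOME g. has_fourier_L2 f g)"

definition H1_space :: "((real ^ 'n::finite) \<Rightarrow> complex) set" where
  "H1_space = {f \<in> L2_space.
     integrable lborel (\<lambda>\<xi>. (1 + (norm \<xi>)\<^sup>2) * (cmod (fourier_L2 f \<xi>))\<^sup>2)}"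

text \<open>The factor makes the square of the norm equal to that of \<open>f\<close> plus that of \<open>\<nabla>f\<close> in \<open>L\<^sup>2\<close>.\<close>

definition H1_norm :: "((real ^ 'n::finite) \<Rightarrow> complex) \<Rightarrow> real" where
  "H1_norm f = sqrt ((\<integral>\<xi>. (1 + (norm \<xi>)\<^sup>2) * (cmod (fourier_L2 f \<xi>))\<^sup>2 \<partial>lborel)
     / (2 * pi) ^ CARD('n))"

definition cont_H1 :: "(real \<Rightarrow> (real ^ 'n::finite) \<Rightarrow> complex) \<Rightarrow> bool" where
  "cont_H1 u \<longleftrightarrow> (\<forall>t\<ge>0. u t \<in> H1_space) \<and>
     (\<forall>t\<ge>0. ((\<lambda>s. H1_norm (\<lambda>x. u s x - u t x)) \<longlongrightarrow> 0) (at t within {0..}))"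

definition cont_L2 :: "(real \<Rightarrow> (real ^ 'n::finite) \<Rightarrow> complex) \<Rightarrow> bool" where
  "cont_L2 u \<longleftrightarrow> (\<forall>t\<ge>0. u t \<in> L2_space) \<and> (\<forall>t\<ge>0. L2_tendsto u (u t) (at t within {0..}))"

definition has_deriv_L2 ::
    "(real \<Rightarrow> (real ^ 'n::finite) \<Rightarrow> complex) \<Rightarrow> (real \<Rightarrow> (real ^ 'n) \<Rightarrow> complex) \<Rightarrow> bool" where
  "has_deriv_L2 u v \<longleftrightarrow>
     (\<forall>t\<ge>0. L2_tendsto (\<lambda>s x. (u s x - u t x) /\<^sub>R (s - t)) (v t) (at t within {0..}))"

text \<open>The symbol of the Fourier multiplier \<open>L = log (I + (-\<Delta>)\<^bsup>1/2\<^esup>)\<close>.\<close>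

definition L_symbol :: "(real ^ 'n::finite) \<Rightarrow> real" where
  "L_symbol \<xi> = ln (1 + norm \<xi>)"

text \<open>
  The Fourier image of \<open>u\<^sub>t\<^sub>t - \<Delta>u + \<mu> L u\<^sub>t = 0\<close>, \<open>u(0) = u0\<close>, \<open>u\<^sub>t(0) = u1\<close>. As \<open>u t\<close> has a
  Fourier transform only up to a null set depending on \<open>t\<close>, the versions \<open>w t\<close> have to be chosen
  such that \<open>\<lambda>t. w t \<xi>\<close> solves the equation for almost every \<open>\<xi>\<close>.
\<close>

definition fourier_equation ::
    "real \<Rightarrow> ((real ^ 'n::finite) \<Rightarrow> complex) \<Rightarrow> ((real ^ 'n) \<Rightarrow> complex) \<Rightarrow>
     (real \<Rightarrow> (real ^ 'n) \<Rightarrow> complex) \<Rightarrow> bool" where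
  "fourier_equation \<mu> u0 u1 u \<longleftrightarrow>
     (\<exists>w w' w''.
        (\<forall>t\<ge>0. has_fourier_L2 (u t) (w t)) \<and>
        has_fourier_L2 u0 (w 0) \<and> has_fourier_L2 u1 (w' 0) \<and>
        (AE \<xi> in lborel. \<forall>t\<ge>0.
           ((\<lambda>s. w s \<xi>) has_vector_derivative w' t \<xi>) (at t within {0..}) \<and>
           ((\<lambda>s. w' s \<xi>) has_vector_derivative w'' t \<xi>) (at t within {0..}) \<and>
           w'' t \<xi> + complex_of_real (\<mu> * L_symbol \<xi>) * w' t \<xi>
             + complex_of_real ((norm \<xi>)\<^sup>2) * w t \<xi> = 0))"

text \<open>
  The solution in \<open>C([0,\<infinity>);H\<^sup>1) \<inter> C\<^sup>1([0,\<infinity>);L\<^sup>2)\<close>. Since \<open>u\<^sub>t\<close> takes values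
  in \<open>L\<^sup>2\<close> only, it need not lie in the domain of \<open>L\<close>, and the equation is imposed on the
  Fourier side.
\<close>

definition mild_solution ::
    "real \<Rightarrow> ((real ^ 'n::finite) \<Rightarrow> complex) \<Rightarrow> ((real ^ 'n) \<Rightarrow> complex) \<Rightarrow>
     (real \<Rightarrow> (real ^ 'n) \<Rightarrow> complex) \<Rightarrow> bool" where
  "mild_solution \<mu> u0 u1 u \<longleftrightarrow>
     cont_H1 u \<and>
     (\<exists>v. cont_L2 v \<and> has_deriv_L2 u v \<and>
        (AE x in lborel. u 0 x = u0 x) \<and> (AE x in lborel. v 0 x = u1 x)) \<and>
     fourier_equation \<mu> u0 u1 u"

end

theory Submission
  imports Defs "HOL-Probability.Probability"
begin

text \<open>
  On the Fourier side the equation is, for each frequency \<open>\<xi>\<close> with \<open>r = norm \<xi>\<close>, a damped oscillator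
  with damping \<open>a = \<mu>/2 ln (1 + r)\<close> and frequency \<open>b = sqrt (r\<^sup>2 - a\<^sup>2)\<close>. Since
  \<open>ln (1 + r) \<le> r\<close> and \<open>\<mu> < 2\<close>, the frequency is real and comparable with \<open>r\<close> uniformly in \<open>\<xi>\<close>, so
  no frequency is overdamped. Solving the oscillator and replacing the transform of
  \<open>u1\<close> by its value \<open>P1\<close> at the origin gives
  \<open>w t \<xi> = exp (- a t) (sin (b t) / b P1 + R)\<close>, where \<open>R\<close> is bounded, uniformly in \<open>t\<close> and \<open>\<xi>\<close>,
  by a multiple of \<open>L1_norm u0 + L11_norm u1\<close>: the singular factor \<open>1/b\<close> is compensated by
  \<open>a \<le> r\<close> in front of \<open>u0\<close>, and by the first moment of \<open>u1\<close>, which makes its transform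
  Lipschitz (lemma \<open>fourier_solution_profile\<close>).

  Everything then follows by scaling \<open>\<xi> = \<eta> / t\<close>. As \<open>exp (- 2 a t) = (1 + r) powr (- \<mu> t)\<close>
  decreases in \<open>t\<close> for fixed \<open>\<eta>\<close>, its integral is at most \<open>J t powr (- n)\<close> for large \<open>t\<close>, in one stroke
  for low and high frequencies (\<open>nn_integral_damping_le\<close>). With \<open>\<bar>sin (b t) / b\<bar> \<le> t\<close> this is the upper
  bound. For the lower bound it suffices to integrate over the ball of radius \<open>1/t\<close>: there
  \<open>a t \<le> 1\<close> and \<open>b t \<le> 1\<close>, so \<open>sin (b t) / b \<ge> t/2\<close>, and the term with \<open>P1\<close> grows like \<open>t\<close>
  and dominates \<open>R\<close> as soon as \<open>t\<close> is large in terms of the data.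

  To return to \<open>u\<close> one needs the Plancherel theorem for the transform defined by truncation
  (\<open>has_fourier_L2_plancherel\<close>), and that it agrees almost everywhere with the Fourier integral on
  \<open>L\<^sup>1\<close> (\<open>has_fourier_L2_eq_fourier\<close>). Plancherel on \<open>L\<^sup>1 \<inter> L\<^sup>2\<close> is proved by Gaussian regularization:
  the integral of \<open>\<bar>fourier f\<bar>\<^sup>2\<close> against a wide Gaussian is a Gaussian average of the
  autocorrelation of \<open>f\<close> near the origin, and the autocorrelation is continuous there because
  translations act continuously on \<open>L\<^sup>2\<close>.
\<close>

section \<open>Lebesgue measure on Euclidean space\<close>

lemma nn_integral_euclidean_affine:
  fixes f :: "'a::euclidean_space \<Rightarrow> ennreal"
  assumes [measurable]: "f \<in> borel_measurable borel" and c: "c \<noteq> 0"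
  shows "(\<integral>\<^sup>+x. f x \<partial>lborel) = ennreal (\<bar>c\<bar> ^ DIM('a)) * (\<integral>\<^sup>+x. f (t + c *\<^sub>R x) \<partial>lborel)"
  by (subst lborel_affine[OF c, of t])
     (simp add: nn_integral_density nn_integral_distr nn_integral_cmult)

lemma integrable_euclidean_affine:
  fixes f :: "'a::euclidean_space \<Rightarrow> 'b::{banach,second_countable_topology}"
  assumes f: "integrable lborel f" and c: "c \<noteq> 0"
  shows "integrable lborel (\<lambda>x. f (t + c *\<^sub>R x))"
proof -
  have [measurable]: "f \<in> borel_measurable borel" using f by simp
  have "(\<integral>\<^sup>+x. ennreal (norm (f x)) \<partial>lborel)
      = ennreal (\<bar>c\<bar> ^ DIM('a)) * (\<integral>\<^sup>+x. ennreal (norm (f (t + c *\<^sub>R x))) \<partial>lborel)"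
    by (rule nn_integral_euclidean_affine) (use c in auto)
  then show ?thesis
    using f c unfolding integrable_iff_bounded by (auto simp: ennreal_mult_less_top)
qed

lemma integral_euclidean_affine:
  fixes f :: "'a::euclidean_space \<Rightarrow> 'b::{banach,second_countable_topology}"
  assumes f: "integrable lborel f" and c: "c \<noteq> 0"
  shows "(\<integral>x. f x \<partial>lborel) = (\<bar>c\<bar> ^ DIM('a)) *\<^sub>R (\<integral>x. f (t + c *\<^sub>R x) \<partial>lborel)"
  using f c f[THEN borel_measurable_integrable] integrable_euclidean_affine[OF f c, of t]
  by (subst lborel_affine[OF c, of t]) (simp add: integral_density integral_distr)

text \<open>Lebesgue measure is the image of a product measure indexed by the basis vectors, not by the
  coordinates; the proof transports Fubini along the bijection between the two index sets.\<close>
lemma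
  fixes f :: "'n::finite \<Rightarrow> real \<Rightarrow> 'b::{real_normed_field,banach,second_countable_topology}"
  assumes f: "\<And>i. integrable lborel (f i)"
  shows integrable_prod_vec: "integrable lborel (\<lambda>x :: real ^ 'n. \<Prod>i\<in>UNIV. f i (x $ i))" (is ?A)
    and integral_prod_vec: "integral\<^sup>L lborel (\<lambda>x :: real ^ 'n. \<Prod>i\<in>UNIV. f i (x $ i)) = (\<Prod>i\<in>UNIV. \<integral>x. f i x \<partial>lborel)" (is ?B)
proof -
  let ?j = "\<lambda>b :: real ^ 'n. THE i. b = axis i 1"
  have j: "?j (axis i 1) = i" for i :: 'n
    by (rule the_equality) (auto simp: axis_eq_axis)
  have Basis: "(Basis :: (real ^ 'n) set) = (\<lambda>i. axis i 1) ` UNIV"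
    by (auto simp: Basis_vec_def)
  have inj: "inj_on (\<lambda>i. axis i (1::real) :: real ^ 'n) UNIV"
    by (auto simp: inj_on_def axis_eq_axis)
  interpret product_sigma_finite "\<lambda>b :: real ^ 'n. lborel :: real measure" ..
  let ?T = "\<lambda>w. \<Sum>b\<in>(Basis :: (real ^ 'n) set). w b *\<^sub>R b"
  have [measurable]: "f i \<in> borel_measurable borel" for i using f[of i] by simp
  have *: "(\<Prod>i\<in>UNIV. f i (?T w $ i)) = (\<Prod>b\<in>Basis. f (?j b) (w b))" for w
  proof -
    have "?T w $ i = w (axis i 1)" for i
    proof -
      have "?T w $ i = ?T w \<bullet> axis i 1" by (simp add: inner_axis)
      also have "\<dots> = w (axis i 1)" by (simp add: axis_in_Basis_iff)
      finally show ?thesis .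
    qed
    then show ?thesis by (simp add: Basis prod.reindex[OF inj] j)
  qed
  have int: "integrable (\<Pi>\<^sub>M b\<in>Basis. lborel) (\<lambda>w. \<Prod>b\<in>(Basis :: (real ^ 'n) set). f (?j b) (w b))"
    by (intro product_integrable_prod f) auto
  show ?A
    by (subst lborel_eq, subst integrable_distr_eq) (use int in \<open>simp_all add: * del: sum_component\<close>)
  show ?B
    by (subst lborel_eq, subst integral_distr)
       (simp_all add: * product_integral_prod[of Basis "\<lambda>b. f (?j b)"] f del: sum_component,
         simp add: Basis prod.reindex[OF inj] j)
qed


section \<open>Gaussians and the multiplication formula\<close>

lemma
  fixes t :: real
  shows integrable_iexp_gaussian:
      "integrable lborel (\<lambda>x. exp (- (\<i> * complex_of_real (x * t))) * complex_of_real (exp (- x\<^sup>2 / 2)))" (is ?A)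
    and integral_iexp_gaussian:
      "(\<integral>x. exp (- (\<i> * complex_of_real (x * t))) * complex_of_real (exp (- x\<^sup>2 / 2)) \<partial>lborel)
        = complex_of_real (sqrt (2 * pi) * exp (- t\<^sup>2 / 2))" (is ?B)
proof -
  have eq: "(\<lambda>x. exp (- (\<i> * complex_of_real (x * t))) * complex_of_real (exp (- x\<^sup>2 / 2)))
      = (\<lambda>x. sqrt (2 * pi) *\<^sub>R (std_normal_density x *\<^sub>R iexp (- t * x)))"
    by (auto simp: fun_eq_iff std_normal_density_def scaleR_conv_of_real mult_ac)
  have int: "integrable lborel (\<lambda>x. std_normal_density x *\<^sub>R iexp (- t * x))"
    by (rule Bochner_Integration.integrable_bound[OF integrable_normal_density[of 1 0]]) simp_all
  show ?A unfolding eq by (intro integrable_scaleR_right int)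
  have "(\<integral>x. std_normal_density x *\<^sub>R iexp (- t * x) \<partial>lborel) = char std_normal_distribution (- t)"
    unfolding char_def by (subst integral_density) simp_all
  then show ?B unfolding eq
    by (subst Bochner_Integration.integral_scaleR_right)
       (simp only: char_std_normal_distribution scaleR_conv_of_real of_real_mult power2_minus)
qed

definition gauss :: "real ^ 'n::finite \<Rightarrow> complex" where
  "gauss x = complex_of_real (exp (- (norm x)\<^sup>2 / 2))"

lemma norm_power2_vec: "(norm (x :: real ^ 'n::finite))\<^sup>2 = (\<Sum>i\<in>UNIV. (x $ i)\<^sup>2)"
  by (simp add: norm_vec_def L2_set_def sum_nonneg)

lemma measurable_gauss [measurable]: "gauss \<in> borel_measurable borel"
  unfolding gauss_def[abs_def] by measurable

lemma
  fixes y :: "real ^ 'n::finite"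
  shows integrable_exp_gauss:
      "integrable lborel (\<lambda>x. exp (- (\<i> * complex_of_real (x \<bullet> y))) * gauss x)" (is ?A)
    and fourier_gauss: "fourier gauss y = complex_of_real (sqrt (2 * pi) ^ CARD('n)) * gauss y" (is ?B)
proof -
  have eq: "(\<lambda>x. exp (- (\<i> * complex_of_real (x \<bullet> y))) * gauss x)
     = (\<lambda>x. \<Prod>i\<in>UNIV. exp (- (\<i> * complex_of_real (x $ i * y $ i))) * complex_of_real (exp (- (x $ i)\<^sup>2 / 2)))"
    by (rule ext) (simp add: gauss_def inner_vec_def norm_power2_vec sum_distrib_left exp_sum
        sum_divide_distrib prod.distrib flip: sum_negf)
  show ?A unfolding eq by (intro integrable_prod_vec integrable_iexp_gaussian)
  have "fourier gauss y = (\<Prod>i\<in>UNIV. complex_of_real (sqrt (2 * pi) * exp (- (y $ i)\<^sup>2 / 2)))"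
    unfolding fourier_def eq by (subst integral_prod_vec) (simp_all only: integrable_iexp_gaussian integral_iexp_gaussian)
  then show ?B
    by (simp add: gauss_def norm_power2_vec exp_sum sum_divide_distrib prod.distrib flip: sum_negf)
qed

lemma integrable_gauss: "integrable lborel gauss"
  using integrable_exp_gauss[of 0] by simp

lemma measurable_fourier_kernel [measurable]:
  "(\<lambda>p. exp (- (\<i> * complex_of_real (fst p \<bullet> snd p)))) \<in> borel_measurable (borel :: ((real ^ 'n::finite) \<times> (real ^ 'n)) measure)"
  by (intro borel_measurable_continuous_onI continuous_intros)

lemma measurable_fourier [measurable]:
  assumes [measurable]: "f \<in> borel_measurable borel"
  shows "fourier f \<in> borel_measurable borel"
  unfolding fourier_def[abs_def] by measurable

lemma norm_fourier_le: "cmod (fourier f \<xi>) \<le> L1_norm f"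
  unfolding fourier_def L1_norm_def
  by (rule order_trans[OF integral_norm_bound]) (simp add: norm_mult)

lemma integrable_fourier_kernel_mult:
  "integrable lborel f \<Longrightarrow> integrable lborel (\<lambda>x. exp (- (\<i> * complex_of_real (x \<bullet> \<xi>))) * f x)"
  by (rule Bochner_Integration.integrable_bound[of _ f]) (auto simp: norm_mult)

text \<open>Moving the transform from one factor to the other is Fubini for the symmetric kernel
  \<open>exp (- \<i> x \<bullet> \<xi>)\<close>. Used twice, this formula computes the Gaussian means of \<open>\<bar>fourier f\<bar>\<^sup>2\<close> without a
  triple integral.\<close>
lemma integral_fourier_mult:
  fixes f g :: "real ^ 'n::finite \<Rightarrow> complex"
  assumes f: "integrable lborel f" and g: "integrable lborel g"
  shows "(\<integral>\<xi>. fourier f \<xi> * g \<xi> \<partial>lborel) = (\<integral>x. f x * fourier g x \<partial>lborel)"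
proof -
  have [measurable]: "f \<in> borel_measurable borel" "g \<in> borel_measurable borel" using f g by auto
  let ?k = "\<lambda>x \<xi>. exp (- (\<i> * complex_of_real (x \<bullet> \<xi>))) * f x * g \<xi>"
  have "integrable (lborel \<Otimes>\<^sub>M lborel) (\<lambda>(x, \<xi>). ?k x \<xi>)"
  proof (rule lborel_pair.Fubini_integrable)
    show "(\<lambda>(x, \<xi>). ?k x \<xi>) \<in> borel_measurable (lborel \<Otimes>\<^sub>M lborel)" by measurable
    show "integrable lborel (\<lambda>x. LINT \<xi>|lborel. norm (case (x, \<xi>) of (x, \<xi>) \<Rightarrow> ?k x \<xi>))"
      using f by (simp add: norm_mult)
    show "AE x in lborel. integrable lborel (\<lambda>\<xi>. case (x, \<xi>) of (x, \<xi>) \<Rightarrow> ?k x \<xi>)"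
      by (rule AE_I2, rule Bochner_Integration.integrable_bound[OF integrable_mult_right[OF g]])
         (auto simp: norm_mult)
  qed
  then have "(\<integral>\<xi>. (\<integral>x. ?k x \<xi> \<partial>lborel) \<partial>lborel) = (\<integral>x. (\<integral>\<xi>. ?k x \<xi> \<partial>lborel) \<partial>lborel)"
    by (rule lborel_pair.Fubini_integral)
  also have "(\<lambda>x. \<integral>\<xi>. ?k x \<xi> \<partial>lborel) = (\<lambda>x. f x * fourier g x)"
  proof
    fix x
    have "(\<integral>\<xi>. ?k x \<xi> \<partial>lborel) = (\<integral>\<xi>. f x * (exp (- (\<i> * complex_of_real (\<xi> \<bullet> x))) * g \<xi>) \<partial>lborel)"
      by (rule Bochner_Integration.integral_cong) (simp_all add: inner_commute mult_ac)
    then show "(\<integral>\<xi>. ?k x \<xi> \<partial>lborel) = f x * fourier g x" by (simp add: fourier_def)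
  qed
  finally show ?thesis by (simp add: fourier_def)
qed

section \<open>Continuity of translations in \<open>L\<^sup>2\<close>\<close>

text \<open>The value in \<open>[0, \<infinity>]\<close> makes triangle inequalities and limits available before
  integrability is known.\<close>
definition L2_ennorm2 :: "(real ^ 'n::finite \<Rightarrow> complex) \<Rightarrow> ennreal" where
  "L2_ennorm2 f = (\<integral>\<^sup>+x. ennreal ((cmod (f x))\<^sup>2) \<partial>lborel)"

lemma L2_space_iff:
  "f \<in> L2_space \<longleftrightarrow> f \<in> borel_measurable borel \<and> L2_ennorm2 f < \<infinity>"
  by (auto simp: L2_space_def L2_ennorm2_def integrable_iff_bounded)

lemma L2_ennorm2_eq:
  assumes "f \<in> L2_space"
  shows "L2_ennorm2 f = ennreal (\<integral>x. (cmod (f x))\<^sup>2 \<partial>lborel)"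
  using assms unfolding L2_ennorm2_def L2_space_def by (intro nn_integral_eq_integral) auto

lemma cmod_add_power2_le: "(cmod (a + b))\<^sup>2 \<le> 2 * (cmod a)\<^sup>2 + 2 * (cmod b)\<^sup>2"
proof -
  have "(cmod (a + b))\<^sup>2 \<le> (cmod a + cmod b)\<^sup>2" by (intro power_mono norm_triangle_ineq) auto
  also have "\<dots> \<le> 2 * (cmod a)\<^sup>2 + 2 * (cmod b)\<^sup>2"
    using sum_squares_bound[of "cmod a" "cmod b"] by (simp add: power2_sum)
  finally show ?thesis .
qed

lemma L2_ennorm2_add_le:
  assumes [measurable]: "f \<in> borel_measurable borel" "g \<in> borel_measurable borel"
  shows "L2_ennorm2 (\<lambda>x. f x + g x) \<le> 2 * L2_ennorm2 f + 2 * L2_ennorm2 g"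
proof -
  have "L2_ennorm2 (\<lambda>x. f x + g x)
      \<le> (\<integral>\<^sup>+x. 2 * ennreal ((cmod (f x))\<^sup>2) + 2 * ennreal ((cmod (g x))\<^sup>2) \<partial>lborel)"
    unfolding L2_ennorm2_def
  proof (rule nn_integral_mono)
    fix x
    have "ennreal ((cmod (f x + g x))\<^sup>2) \<le> ennreal (2 * (cmod (f x))\<^sup>2 + 2 * (cmod (g x))\<^sup>2)"
      by (intro ennreal_leI cmod_add_power2_le)
    then show "ennreal ((cmod (f x + g x))\<^sup>2) \<le> 2 * ennreal ((cmod (f x))\<^sup>2) + 2 * ennreal ((cmod (g x))\<^sup>2)"
      by (simp add: ennreal_mult')
  qed
  also have "\<dots> = 2 * L2_ennorm2 f + 2 * L2_ennorm2 g"
    by (simp add: L2_ennorm2_def nn_integral_add nn_integral_cmult)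
  finally show ?thesis .
qed

lemma L2_ennorm2_minus_commute: "L2_ennorm2 (\<lambda>x. f x - g x) = L2_ennorm2 (\<lambda>x. g x - f x)"
  by (simp add: L2_ennorm2_def norm_minus_commute)

lemma L2_ennorm2_diff_triangle:
  assumes [measurable]: "f \<in> borel_measurable borel" "g \<in> borel_measurable borel" "h \<in> borel_measurable borel"
  shows "L2_ennorm2 (\<lambda>x. f x - h x) \<le> 2 * L2_ennorm2 (\<lambda>x. f x - g x) + 2 * L2_ennorm2 (\<lambda>x. g x - h x)"
  using L2_ennorm2_add_le[of "\<lambda>x. f x - g x" "\<lambda>x. g x - h x"] by simp

lemma L2_ennorm2_translate:
  assumes [measurable]: "f \<in> borel_measurable borel"
  shows "L2_ennorm2 (\<lambda>x. f (x - z)) = L2_ennorm2 f"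
  unfolding L2_ennorm2_def
  using nn_integral_euclidean_affine[of "\<lambda>x. ennreal ((cmod (f x))\<^sup>2)" 1 "- z"]
  by simp

lemma L2_ennorm2_dominated_convergence:
  assumes [measurable]: "\<And>k. F k \<in> borel_measurable borel"
    and w[measurable]: "w \<in> borel_measurable borel" and fin: "(\<integral>\<^sup>+x. ennreal (w x) \<partial>lborel) < \<infinity>"
    and dom: "\<And>k x. (cmod (F k x))\<^sup>2 \<le> w x"
    and lim: "AE x in lborel. (\<lambda>k. F k x) \<longlonglongrightarrow> 0"
  shows "(\<lambda>k. L2_ennorm2 (F k)) \<longlonglongrightarrow> 0"
proof -
  have "(\<lambda>k. \<integral>\<^sup>+x. ennreal ((cmod (F k x))\<^sup>2) \<partial>lborel) \<longlonglongrightarrow> (\<integral>\<^sup>+x. 0 \<partial>(lborel :: (real ^ 'a) measure))"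
  proof (rule nn_integral_dominated_convergence[where w = "\<lambda>x. ennreal (w x)"])
    show "AE x in lborel. ennreal ((cmod (F k x))\<^sup>2) \<le> ennreal (w x)" for k
      using dom by (auto intro: ennreal_leI)
    show "AE x in lborel. (\<lambda>k. ennreal ((cmod (F k x))\<^sup>2)) \<longlonglongrightarrow> 0"
      using lim
    proof eventually_elim
      case (elim x)
      have "(\<lambda>k. (cmod (F k x))\<^sup>2) \<longlonglongrightarrow> 0"
        using tendsto_power[OF tendsto_norm_zero[OF elim], of 2] by simp
      then show ?case
        using tendsto_ennrealI[of _ 0] by fastforce
    qed
  qed (use fin in auto)
  then show ?thesis by (simp add: L2_ennorm2_def)
qed

lemma nn_integral_const_on_cball_finite:
  "(\<integral>\<^sup>+x. ennreal (c * indicator (cball 0 N) (x :: real ^ 'n::finite)) \<partial>lborel) < \<infinity>"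
proof -
  have "(\<integral>\<^sup>+x. ennreal (c * indicator (cball 0 N) (x :: real ^ 'n)) \<partial>lborel)
     = (\<integral>\<^sup>+x. ennreal c * indicator (cball 0 N) (x :: real ^ 'n) \<partial>lborel)"
    by (intro nn_integral_cong) (auto simp: indicator_def)
  also have "\<dots> = ennreal c * emeasure lborel (cball (0 :: real ^ 'n) N)"
    by (rule nn_integral_cmult_indicator) simp
  also have "\<dots> < \<infinity>"
    using emeasure_lborel_cball_finite[of "0 :: real ^ 'n" N] by (simp add: ennreal_mult_less_top)
  finally show ?thesis .
qed

text \<open>The form in which dominated convergence is applied to functions supported in a common ball.\<close>
lemma L2_ennorm2_bounded_convergence:
  fixes F :: "nat \<Rightarrow> real ^ 'n::finite \<Rightarrow> complex"
  assumes meas: "\<And>k. F k \<in> borel_measurable borel"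
    and bound: "\<And>k x. cmod (F k x) \<le> M" and support: "\<And>k x. N < norm x \<Longrightarrow> F k x = 0"
    and lim: "AE x in lborel. (\<lambda>k. F k x) \<longlonglongrightarrow> 0"
  shows "(\<lambda>k. L2_ennorm2 (F k)) \<longlonglongrightarrow> 0"
proof (rule L2_ennorm2_dominated_convergence[OF meas _ _ _ lim])
  show "(\<lambda>x. M\<^sup>2 * indicator (cball 0 N) x) \<in> borel_measurable (borel :: (real ^ 'n) measure)"
    by (intro borel_measurable_times borel_measurable_const borel_measurable_indicator) simp
  show "(\<integral>\<^sup>+x. ennreal (M\<^sup>2 * indicator (cball 0 N) (x :: real ^ 'n)) \<partial>lborel) < \<infinity>"
    by (rule nn_integral_const_on_cball_finite)
  show "(cmod (F k x))\<^sup>2 \<le> M\<^sup>2 * indicator (cball 0 N) x" for k x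
    using power_mono[OF bound[of k x] norm_ge_zero, of 2] support[of x k]
    by (cases "norm x \<le> N") auto
qed

text \<open>A measurable function is an almost everywhere limit of continuous functions. Projecting their values
  to the ball of radius \<open>M\<close> and multiplying by a cut-off does not change the limit, since \<open>f\<close> itself is
  bounded by \<open>M\<close> and vanishes outside the ball of radius \<open>N\<close>, and it makes the convergence dominated.\<close>
lemma bounded_support_approx_continuous:
  fixes f :: "real ^ 'n::finite \<Rightarrow> complex"
  assumes f[measurable]: "f \<in> borel_measurable borel"
    and M: "\<And>x. cmod (f x) \<le> M" and N: "\<And>x. N < norm x \<Longrightarrow> f x = 0" and "0 < e"
  shows "\<exists>h. continuous_on UNIV h \<and> (\<forall>x. cmod (h x) \<le> M) \<and> (\<forall>x. N + 1 < norm x \<longrightarrow> h x = 0)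
           \<and> L2_ennorm2 (\<lambda>x. f x - h x) < e"
proof -
  have M0: "0 \<le> M" using M[of 0] norm_ge_zero order_trans by blast
  have "f \<in> borel_measurable lebesgue" by (simp add: measurable_completion)
  then have "f measurable_on UNIV"
    by (simp add: measurable_on_iff_borel_measurable)
  then obtain S g where S: "negligible S" and contg: "\<And>n. continuous_on UNIV (g n)"
    and lim: "\<And>x. x \<notin> S \<Longrightarrow> (\<lambda>n. g n x) \<longlonglongrightarrow> f x"
    unfolding measurable_on_def by auto
  have AElim: "AE x in lborel. (\<lambda>n. g n x) \<longlonglongrightarrow> f x"
  proof -
    have "S \<in> null_sets lebesgue" using S by (simp add: negligible_iff_null_sets)
    then have "AE x in lebesgue. (\<lambda>n. g n x) \<longlonglongrightarrow> f x"
      by (rule AE_I') (use lim in auto)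
    then show ?thesis by (simp add: AE_completion_iff)
  qed
  \<comment> \<open>\<open>\<theta>\<close> is a cut-off equal to \<open>1\<close> on the ball of radius \<open>N\<close>; \<open>clip\<close> is continuous as the projection to a
    convex set.\<close>
  define \<theta> where "\<theta> x = max 0 (min 1 (N + 1 - norm x))" for x :: "real ^ 'n"
  define clip where "clip z = closest_point (cball 0 M) z" for z :: complex
  have clip_le: "cmod (clip z) \<le> M" for z
    using closest_point_in_set[of "cball 0 M" z] M0 by (simp add: clip_def)
  have clip_id: "clip z = z" if "cmod z \<le> M" for z
    using that by (simp add: clip_def closest_point_self)
  have contclip: "continuous_on UNIV clip"
    unfolding clip_def using M0 by (intro continuous_on_closest_point) auto
  define h where "h n x = complex_of_real (\<theta> x) * clip (g n x)" for n x
  have th: "0 \<le> \<theta> x" "\<theta> x \<le> 1" for x by (auto simp: \<theta>_def)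
  have conth: "continuous_on UNIV (h n)" for n
  proof -
    have "continuous_on UNIV (\<lambda>x. clip (g n x))"
      using continuous_on_compose2[OF contclip contg] by auto
    moreover have "continuous_on UNIV \<theta>" unfolding \<theta>_def by (intro continuous_intros)
    ultimately show ?thesis unfolding h_def by (intro continuous_intros) auto
  qed
  then have [measurable]: "h n \<in> borel_measurable borel" for n
    by (rule borel_measurable_continuous_onI)
  have h_le: "cmod (h n x) \<le> M" for n x
  proof -
    have "cmod (h n x) \<le> 1 * M" unfolding h_def norm_mult
      by (intro mult_mono) (use th clip_le in auto)
    then show ?thesis by simp
  qed
  have h0: "h n x = 0" if "N + 1 < norm x" for n x using that by (simp add: h_def \<theta>_def)
  have "(\<lambda>n. L2_ennorm2 (\<lambda>x. f x - h n x)) \<longlonglongrightarrow> 0"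
  proof (rule L2_ennorm2_bounded_convergence)
    show "cmod (f x - h k x) \<le> 2 * M" for k x
      using norm_triangle_ineq4[of "f x" "h k x"] M[of x] h_le[of k x] by linarith
    show "f x - h k x = 0" if "N + 1 < norm x" for k x
      using N[of x] h0[of x k] that by simp
    show "AE x in lborel. (\<lambda>k. f x - h k x) \<longlonglongrightarrow> 0"
      using AElim
    proof eventually_elim
      case (elim x)
      have "isCont clip (f x)"
        using contclip continuous_on_eq_continuous_at[of UNIV clip] by auto
      then have "(\<lambda>k. clip (g k x)) \<longlonglongrightarrow> clip (f x)"
        using elim by (rule isCont_tendsto_compose)
      then have "(\<lambda>k. h k x) \<longlonglongrightarrow> complex_of_real (\<theta> x) * clip (f x)"
        unfolding h_def by (intro tendsto_intros)
      moreover have "complex_of_real (\<theta> x) * clip (f x) = f x"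
      proof (cases "norm x \<le> N")
        case True
        then show ?thesis using M[of x] by (simp add: \<theta>_def clip_id)
      next
        case False
        then show ?thesis using N[of x] M0 by (simp add: clip_id)
      qed
      ultimately have "(\<lambda>k. f x - h k x) \<longlonglongrightarrow> f x - f x" by (intro tendsto_intros) simp
      then show ?case by simp
    qed
  qed measurable
  then have "eventually (\<lambda>n. L2_ennorm2 (\<lambda>x. f x - h n x) < e) sequentially"
    using \<open>0 < e\<close> by (rule order_tendstoD)
  then obtain n where "L2_ennorm2 (\<lambda>x. f x - h n x) < e" by (auto simp: eventually_sequentially)
  then show ?thesis using conth h_le h0 by blast
qed

text \<open>Truncating both the domain and the values of \<open>f\<close> reduces the claim to bounded functions with
  bounded support.\<close>
lemma L2_approx_continuous_bounded_support:
  fixes f :: "real ^ 'n::finite \<Rightarrow> complex"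
  assumes f: "f \<in> L2_space" and "0 < e"
  shows "\<exists>h M N. continuous_on UNIV h \<and> (\<forall>x. cmod (h x) \<le> M) \<and> (\<forall>x. N < norm x \<longrightarrow> h x = 0)
           \<and> L2_ennorm2 (\<lambda>x. f x - h x) < e"
proof -
  have [measurable]: "f \<in> borel_measurable borel" using f by (simp add: L2_space_iff)
  \<comment> \<open>The triangle inequality for squared norms costs a factor \<open>2\<close> on each of two terms.\<close>
  define e' where "e' = e / 4"
  have e': "0 < e'" using \<open>0 < e\<close> by (simp add: e'_def ennreal_zero_less_divide)
  define F where "F k x = (if norm x \<le> real k \<and> cmod (f x) \<le> real k then f x else 0)" for k :: nat and x
  have [measurable]: "F k \<in> borel_measurable borel" for k unfolding F_def by measurable
  have "(\<lambda>k. L2_ennorm2 (\<lambda>x. f x - F k x)) \<longlonglongrightarrow> 0"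
  proof (rule L2_ennorm2_dominated_convergence[where w = "\<lambda>x. (cmod (f x))\<^sup>2"])
    show "(\<integral>\<^sup>+x. ennreal ((cmod (f x))\<^sup>2) \<partial>lborel) < \<infinity>"
      using f by (simp add: L2_space_iff L2_ennorm2_def)
    show "AE x in lborel. (\<lambda>k. f x - F k x) \<longlonglongrightarrow> 0"
    proof (rule AE_I2, rule tendsto_eventually)
      fix x
      obtain k0 :: nat where k0: "max (norm x) (cmod (f x)) \<le> real k0" using real_arch_simple by blast
      show "\<forall>\<^sub>F k in sequentially. f x - F k x = 0"
        unfolding eventually_sequentially
        by (rule exI[of _ k0]) (use k0 in \<open>auto simp: F_def\<close>)
    qed
  qed (auto simp: F_def)
  then have "eventually (\<lambda>k. L2_ennorm2 (\<lambda>x. f x - F k x) < e') sequentially"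
    using e' by (rule order_tendstoD)
  then obtain k where k: "L2_ennorm2 (\<lambda>x. f x - F k x) < e'" by (auto simp: eventually_sequentially)
  obtain h where h: "continuous_on UNIV h" "\<And>x. cmod (h x) \<le> real k" "\<And>x. real k + 1 < norm x \<Longrightarrow> h x = 0"
      "L2_ennorm2 (\<lambda>x. F k x - h x) < e'"
  proof -
    have "cmod (F k x) \<le> real k" "real k < norm x \<Longrightarrow> F k x = 0" for x by (auto simp: F_def)
    then show ?thesis
      using bounded_support_approx_continuous[of "F k" "real k" "real k" e'] e' that by auto
  qed
  have [measurable]: "h \<in> borel_measurable borel" using h(1) by (rule borel_measurable_continuous_onI)
  have "L2_ennorm2 (\<lambda>x. f x - h x) \<le> 2 * L2_ennorm2 (\<lambda>x. f x - F k x) + 2 * L2_ennorm2 (\<lambda>x. F k x - h x)"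
    by (intro L2_ennorm2_diff_triangle) auto
  also have "\<dots> < 2 * e' + 2 * e'"
    using k h(4) by (intro add_strict_mono ennreal_mult_strict_left_mono) auto
  also have "\<dots> = e"
  proof -
    have "2 * e' + 2 * e' = 4 * e'" by (simp flip: distrib_right)
    then show ?thesis by (simp add: e'_def ennreal_times_divide mult_divide_eq_ennreal mult.commute)
  qed
  finally show ?thesis using h by blast
qed

text \<open>For a continuous function with bounded support this is dominated convergence; the general case
  follows since translations are isometries, so that an approximation of \<open>f\<close> is equally good
  after translation.\<close>
lemma L2_translation_continuous:
  fixes f :: "real ^ 'n::finite \<Rightarrow> complex"
  assumes f: "f \<in> L2_space" and Z: "Z \<longlonglongrightarrow> 0"
  shows "(\<lambda>k. L2_ennorm2 (\<lambda>x. f x - f (x - Z k))) \<longlonglongrightarrow> 0"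
proof (rule order_tendstoI)
  fix e :: ennreal assume "0 < e"
  have [measurable]: "f \<in> borel_measurable borel" using f by (simp add: L2_space_iff)
  \<comment> \<open>The triangle inequality below costs \<open>2 + 2 * (2 + 2) = 10\<close> copies of \<open>e'\<close>.\<close>
  define e' where "e' = e / 10"
  have e': "0 < e'" using \<open>0 < e\<close> by (simp add: e'_def ennreal_zero_less_divide)
  obtain h M N where h: "continuous_on UNIV h" "\<And>x. cmod (h x) \<le> M" "\<And>x. N < norm x \<Longrightarrow> h x = 0"
      and close: "L2_ennorm2 (\<lambda>x. f x - h x) < e'"
    using L2_approx_continuous_bounded_support[OF f e'] by blast
  have [measurable]: "h \<in> borel_measurable borel" using h(1) by (rule borel_measurable_continuous_onI)
  obtain B where B: "\<And>k. norm (Z k) \<le> B"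
    using Z convergent_imp_Bseq[of Z] by (auto simp: convergent_def Bseq_def)
  have "(\<lambda>k. L2_ennorm2 (\<lambda>x. h x - h (x - Z k))) \<longlonglongrightarrow> 0"
  proof (rule L2_ennorm2_bounded_convergence)
    show "cmod (h x - h (x - Z k)) \<le> 2 * M" for k x
      using norm_triangle_ineq4[of "h x" "h (x - Z k)"] h(2)[of x] h(2)[of "x - Z k"] by linarith
    show "h x - h (x - Z k) = 0" if "N + B < norm x" for k x
    proof -
      have "norm x \<le> norm (x - Z k) + norm (Z k)" using norm_triangle_ineq[of "x - Z k" "Z k"] by simp
      then have "N < norm (x - Z k)" "N < norm x"
        using that B[of k] norm_ge_zero[of "Z k"] by linarith+
      then show ?thesis using h(3) by simp
    qed
    show "AE x in lborel. (\<lambda>k. h x - h (x - Z k)) \<longlonglongrightarrow> 0"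
    proof (rule AE_I2)
      fix x
      have "isCont h x" using h(1) continuous_on_eq_continuous_at[of UNIV h] by auto
      moreover have "(\<lambda>k. x - Z k) \<longlonglongrightarrow> x" using tendsto_diff[OF tendsto_const Z, of x] by simp
      ultimately have "(\<lambda>k. h (x - Z k)) \<longlonglongrightarrow> h x" by (rule isCont_tendsto_compose)
      then show "(\<lambda>k. h x - h (x - Z k)) \<longlonglongrightarrow> 0" using tendsto_diff[OF tendsto_const, of _ "h x" sequentially "h x"] by simp
    qed
  qed measurable
  then have "eventually (\<lambda>k. L2_ennorm2 (\<lambda>x. h x - h (x - Z k)) < e') sequentially"
    using e' by (rule order_tendstoD)
  then show "eventually (\<lambda>k. L2_ennorm2 (\<lambda>x. f x - f (x - Z k)) < e) sequentially"
  proof eventually_elim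
    case (elim k)
    have "L2_ennorm2 (\<lambda>x. f x - f (x - Z k)) \<le> 2 * L2_ennorm2 (\<lambda>x. f x - h x) + 2 * L2_ennorm2 (\<lambda>x. h x - f (x - Z k))"
      by (intro L2_ennorm2_diff_triangle) auto
    also have "\<dots> \<le> 2 * L2_ennorm2 (\<lambda>x. f x - h x)
        + 2 * (2 * L2_ennorm2 (\<lambda>x. h x - h (x - Z k)) + 2 * L2_ennorm2 (\<lambda>x. h (x - Z k) - f (x - Z k)))"
      by (intro add_left_mono mult_left_mono L2_ennorm2_diff_triangle) auto
    also have "L2_ennorm2 (\<lambda>x. h (x - Z k) - f (x - Z k)) = L2_ennorm2 (\<lambda>x. f x - h x)"
      using L2_ennorm2_translate[of "\<lambda>x. h x - f x" "Z k"] by (simp add: L2_ennorm2_minus_commute[of h f])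
    also have "2 * L2_ennorm2 (\<lambda>x. f x - h x) + 2 * (2 * L2_ennorm2 (\<lambda>x. h x - h (x - Z k)) + 2 * L2_ennorm2 (\<lambda>x. f x - h x))
        < 2 * e' + 2 * (2 * e' + 2 * e')"
      using close elim by (intro add_strict_mono ennreal_mult_strict_left_mono) auto
    also have "\<dots> = 10 * e'"
      by (simp flip: distrib_right)
    also have "10 * e' = e"
      by (simp add: e'_def ennreal_times_divide mult_divide_eq_ennreal mult.commute)
    finally show ?case .
  qed
qed simp

section \<open>The Plancherel theorem\<close>

lemma
  shows integral_gauss:
      "integral\<^sup>L lborel (\<lambda>x :: real ^ 'n::finite. exp (- (norm x)\<^sup>2 / 2)) = sqrt (2 * pi) ^ CARD('n)"
    and integrable_real_gauss: "integrable lborel (\<lambda>x :: real ^ 'n. exp (- (norm x)\<^sup>2 / 2))"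
proof -
  have "complex_of_real (integral\<^sup>L lborel (\<lambda>x :: real ^ 'n. exp (- (norm x)\<^sup>2 / 2))) = integral\<^sup>L lborel (gauss :: real ^ 'n \<Rightarrow> complex)"
    unfolding gauss_def[abs_def] by (rule integral_complex_of_real[symmetric])
  also have "\<dots> = fourier gauss (0 :: real ^ 'n)" by (simp add: fourier_def)
  also have "\<dots> = complex_of_real (sqrt (2 * pi) ^ CARD('n))"
    by (subst fourier_gauss) (simp add: gauss_def)
  finally show "integral\<^sup>L lborel (\<lambda>x :: real ^ 'n. exp (- (norm x)\<^sup>2 / 2)) = sqrt (2 * pi) ^ CARD('n)"
    by (simp only: of_real_eq_iff)
  show "integrable lborel (\<lambda>x :: real ^ 'n. exp (- (norm x)\<^sup>2 / 2))"
    using integrable_gauss[where 'a = 'n] unfolding gauss_def[abs_def] by (simp only: complex_of_real_integrable_eq)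
qed

text \<open>Widening a Gaussian concentrates its transform; the evaluation at \<open>\<delta> *\<^sub>R z\<close> is prepared for the
  substitution \<open>z \<mapsto> \<delta> *\<^sub>R z\<close>.\<close>
lemma fourier_gauss_scale:
  fixes z :: "real ^ 'n::finite"
  assumes "0 < \<delta>"
  shows "complex_of_real (\<delta> ^ CARD('n)) * fourier (\<lambda>\<xi>. gauss (\<delta> *\<^sub>R \<xi>)) (\<delta> *\<^sub>R z)
       = complex_of_real (sqrt (2 * pi) ^ CARD('n)) * gauss z"
proof -
  have "fourier gauss z = (\<integral>x. exp (- (\<i> * complex_of_real (x \<bullet> z))) * gauss x \<partial>lborel)"
    by (simp add: fourier_def)
  also have "\<dots> = (\<bar>\<delta>\<bar> ^ DIM(real ^ 'n)) *\<^sub>R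
      (\<integral>x. exp (- (\<i> * complex_of_real ((0 + \<delta> *\<^sub>R x) \<bullet> z))) * gauss (0 + \<delta> *\<^sub>R x) \<partial>lborel)"
    by (rule integral_euclidean_affine[OF integrable_exp_gauss]) (use assms in simp)
  also have "\<dots> = complex_of_real (\<delta> ^ CARD('n)) * fourier (\<lambda>\<xi>. gauss (\<delta> *\<^sub>R \<xi>)) (\<delta> *\<^sub>R z)"
    using assms by (simp add: fourier_def scaleR_conv_of_real[where 'a = complex])
  finally show ?thesis by (simp add: fourier_gauss)
qed

definition autocorrelation :: "(real ^ 'n::finite \<Rightarrow> complex) \<Rightarrow> real ^ 'n \<Rightarrow> complex" where
  "autocorrelation f z = (\<integral>x. f x * cnj (f (x - z)) \<partial>lborel)"

lemma measurable_cnj [measurable]: "cnj \<in> borel_measurable borel"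
  by (intro borel_measurable_continuous_onI continuous_intros)

lemma integrable_translate:
  fixes f :: "'a::euclidean_space \<Rightarrow> 'b::{banach,second_countable_topology}"
  shows "integrable lborel f \<Longrightarrow> integrable lborel (\<lambda>x. f (x - z))"
  using integrable_euclidean_affine[of f 1 "- z"] by simp

lemma integral_translate:
  fixes f :: "'a::euclidean_space \<Rightarrow> 'b::{banach,second_countable_topology}"
  shows "integrable lborel f \<Longrightarrow> (\<integral>x. f (x - z) \<partial>lborel) = (\<integral>x. f x \<partial>lborel)"
  using integral_euclidean_affine[of f 1 "- z"] by simp

text \<open>The real part is computed by polarization, which expresses the autocorrelation through the \<open>L\<^sup>2\<close> distance
  of \<open>f\<close> from its translate. Its continuity at the origin thus is the continuity of translations.\<close>
lemma
  assumes f: "f \<in> L2_space"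
  shows integrable_autocorrelation: "integrable lborel (\<lambda>x. f x * cnj (f (x - z)))"
    and integral_norm_autocorrelation:
      "(\<integral>x. cmod (f x * cnj (f (x - z))) \<partial>lborel) \<le> (\<integral>x. (cmod (f x))\<^sup>2 \<partial>lborel)"
    and Re_autocorrelation: "Re (autocorrelation f z)
      = (\<integral>x. (cmod (f x))\<^sup>2 \<partial>lborel) - enn2real (L2_ennorm2 (\<lambda>x. f x - f (x - z))) / 2"
proof -
  have [measurable]: "f \<in> borel_measurable borel" and f2: "integrable lborel (\<lambda>x. (cmod (f x))\<^sup>2)"
    using f by (auto simp: L2_space_def)
  have f2z: "integrable lborel (\<lambda>x. (cmod (f (x - z)))\<^sup>2)"
    using integrable_translate[OF f2] .
  have le: "cmod (f x * cnj (f (x - z))) \<le> ((cmod (f x))\<^sup>2 + (cmod (f (x - z)))\<^sup>2) / 2" for x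
    using sum_squares_bound[of "cmod (f x)" "cmod (f (x - z))"] by (simp add: norm_mult)
  show int: "integrable lborel (\<lambda>x. f x * cnj (f (x - z)))"
    by (rule Bochner_Integration.integrable_bound[OF integrable_divide[OF Bochner_Integration.integrable_add[OF f2 f2z], of 2]])
       (use le in \<open>auto intro!: order_trans[OF le]\<close>)
  have "(\<integral>x. cmod (f x * cnj (f (x - z))) \<partial>lborel) \<le> (\<integral>x. ((cmod (f x))\<^sup>2 + (cmod (f (x - z)))\<^sup>2) / 2 \<partial>lborel)"
    by (intro integral_mono integrable_norm int integrable_divide Bochner_Integration.integrable_add f2 f2z le)
  also have "\<dots> = (\<integral>x. (cmod (f x))\<^sup>2 \<partial>lborel)"
    using f2 f2z integral_translate[OF f2, of z] by simp
  finally show "(\<integral>x. cmod (f x * cnj (f (x - z))) \<partial>lborel) \<le> (\<integral>x. (cmod (f x))\<^sup>2 \<partial>lborel)" .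
  have polar: "(cmod (f x - f (x - z)))\<^sup>2 = (cmod (f x))\<^sup>2 + (cmod (f (x - z)))\<^sup>2 - 2 * Re (f x * cnj (f (x - z)))" for x
    by (simp add: cmod_power2) (simp add: power2_eq_square algebra_simps)
  have "integrable lborel (\<lambda>x. (cmod (f x - f (x - z)))\<^sup>2)"
    unfolding polar
    by (intro Bochner_Integration.integrable_add Bochner_Integration.integrable_diff f2 f2z
        integrable_mult_right integrable_Re int)
  then have "enn2real (L2_ennorm2 (\<lambda>x. f x - f (x - z))) = (\<integral>x. (cmod (f x - f (x - z)))\<^sup>2 \<partial>lborel)"
    unfolding L2_ennorm2_def by (subst nn_integral_eq_integral) auto
  also have "\<dots> = 2 * (\<integral>x. (cmod (f x))\<^sup>2 \<partial>lborel) - 2 * Re (autocorrelation f z)"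
    unfolding polar autocorrelation_def
    using f2 f2z integrable_mult_right[OF integrable_Re[OF int], of 2] integral_translate[OF f2, of z]
      integral_Re[OF int]
    by (simp del: times_complex.sel)
  finally show "Re (autocorrelation f z)
      = (\<integral>x. (cmod (f x))\<^sup>2 \<partial>lborel) - enn2real (L2_ennorm2 (\<lambda>x. f x - f (x - z))) / 2"
    by (simp add: field_simps)
qed

lemma cmod_autocorrelation_le:
  "f \<in> L2_space \<Longrightarrow> cmod (autocorrelation f z) \<le> (\<integral>x. (cmod (f x))\<^sup>2 \<partial>lborel)"
  unfolding autocorrelation_def
  by (rule order_trans[OF integral_norm_bound integral_norm_autocorrelation])

lemma cnj_fourier:
  assumes f: "integrable lborel f"
  shows "cnj (fourier f \<xi>) = fourier (\<lambda>y. cnj (f (- y))) \<xi>"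
proof -
  let ?g = "\<lambda>y. exp (- (\<i> * complex_of_real (y \<bullet> \<xi>))) * cnj (f (- y))"
  have fm: "integrable lborel (\<lambda>y. cnj (f (- y)))"
    using integrable_euclidean_affine[OF f, of "-1" 0] by simp
  have "fourier (\<lambda>y. cnj (f (- y))) \<xi> = (\<integral>y. ?g y \<partial>lborel)" by (simp add: fourier_def)
  also have "\<dots> = (\<integral>y. ?g (0 + (-1) *\<^sub>R y) \<partial>lborel)"
    using integral_euclidean_affine[OF integrable_fourier_kernel_mult[OF fm, of \<xi>], of "-1" 0] by simp
  also have "(\<lambda>y. ?g (0 + (-1) *\<^sub>R y)) = (\<lambda>y. cnj (exp (- (\<i> * complex_of_real (y \<bullet> \<xi>))) * f y))"
    by (simp add: fun_eq_iff exp_cnj)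
  also have "(\<integral>y. cnj (exp (- (\<i> * complex_of_real (y \<bullet> \<xi>))) * f y) \<partial>lborel) = cnj (fourier f \<xi>)"
    unfolding fourier_def by (rule Bochner_Integration.integral_cnj)
  finally show ?thesis by simp
qed

text \<open>Write \<open>\<gamma>\<close> for the Gaussian weight. The multiplication formula, applied to \<open>f\<close> and
  \<open>h = cnj (fourier f) \<gamma>\<close>, moves the first transform to \<open>h\<close>. Applied once more it
  turns \<open>fourier h\<close> into the convolution of \<open>fourier \<gamma>\<close> with \<open>cnj f\<close>, up to reflections. Integrating against \<open>f\<close>
  produces the autocorrelation.\<close>
lemma integral_fourier_sq_gauss:
  fixes f :: "real ^ 'n::finite \<Rightarrow> complex"
  assumes f1: "f \<in> L1_space" and f2: "f \<in> L2_space" and \<delta>: "0 < \<delta>"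
  shows "integrable lborel (\<lambda>\<xi>. (cmod (fourier f \<xi>))\<^sup>2 * exp (- (norm (\<delta> *\<^sub>R \<xi>))\<^sup>2 / 2))" (is ?I)
    and "(\<integral>\<xi>. (cmod (fourier f \<xi>))\<^sup>2 * exp (- (norm (\<delta> *\<^sub>R \<xi>))\<^sup>2 / 2) \<partial>lborel)
       = sqrt (2 * pi) ^ CARD('n) * (\<integral>s. exp (- (norm s)\<^sup>2 / 2) * Re (autocorrelation f (\<delta> *\<^sub>R s)) \<partial>lborel)" (is ?E)
proof -
  have f: "integrable lborel f" using f1 by (simp add: L1_space_def)
  have [measurable]: "f \<in> borel_measurable borel" using f by simp
  define \<gamma> where "\<gamma> \<xi> = gauss (\<delta> *\<^sub>R \<xi>)" for \<xi> :: "real ^ 'n"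
  define \<Gamma> where "\<Gamma> = fourier \<gamma>"
  define h where "h \<xi> = cnj (fourier f \<xi>) * \<gamma> \<xi>" for \<xi>
  have \<gamma>: "integrable lborel \<gamma>"
    using integrable_euclidean_affine[OF integrable_gauss, of \<delta> 0] \<delta> by (simp add: \<gamma>_def[abs_def])
  then have [measurable]: "\<gamma> \<in> borel_measurable borel" by simp
  have \<Gamma>_scale: "complex_of_real (\<delta> ^ CARD('n)) * \<Gamma> (\<delta> *\<^sub>R z) = complex_of_real (sqrt (2 * pi) ^ CARD('n)) * gauss z" for z
    unfolding \<Gamma>_def \<gamma>_def by (rule fourier_gauss_scale[OF \<delta>])
  have \<Gamma>_eq: "\<Gamma> z = complex_of_real ((sqrt (2 * pi) / \<delta>) ^ CARD('n)) * gauss (0 + (1 / \<delta>) *\<^sub>R z)" for z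
    using \<Gamma>_scale[of "(1 / \<delta>) *\<^sub>R z"] \<delta> by (simp add: power_divide field_simps)
  have \<Gamma>: "integrable lborel \<Gamma>"
    unfolding \<Gamma>_eq[abs_def] using \<delta> by (intro integrable_mult_right integrable_euclidean_affine integrable_gauss) simp
  have h: "integrable lborel h"
    by (rule Bochner_Integration.integrable_bound[OF integrable_mult_right[OF \<gamma>, of "L1_norm f"]])
       (auto simp: h_def[abs_def] norm_mult L1_norm_def[symmetric] intro!: mult_right_mono norm_fourier_le
          order_trans[OF norm_fourier_le] abs_ge_self)
  have h_eq: "fourier f \<xi> * h \<xi> = complex_of_real ((cmod (fourier f \<xi>))\<^sup>2 * exp (- (norm (\<delta> *\<^sub>R \<xi>))\<^sup>2 / 2))" for \<xi>
    by (simp add: h_def \<gamma>_def gauss_def complex_norm_square[symmetric] mult.assoc[symmetric])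
  have "integrable lborel (\<lambda>\<xi>. fourier f \<xi> * h \<xi>)"
    by (rule Bochner_Integration.integrable_bound[OF integrable_mult_right[OF h, of "L1_norm f"]])
       (use h in \<open>auto simp: norm_mult intro!: mult_right_mono order_trans[OF norm_fourier_le] abs_ge_self\<close>)
  then show ?I unfolding h_eq by (simp only: complex_of_real_integrable_eq)
  have fourier_h: "fourier h x = (\<integral>z. \<Gamma> z * cnj (f (x - z)) \<partial>lborel)" for x
  proof -
    let ?k = "\<lambda>\<xi>. exp (- (\<i> * complex_of_real (\<xi> \<bullet> x))) * \<gamma> \<xi>"
    let ?f' = "\<lambda>y. cnj (f (- y))"
    have f': "integrable lborel ?f'"
      using integrable_euclidean_affine[OF f, of "-1" 0] by simp
    have k: "integrable lborel ?k" by (rule integrable_fourier_kernel_mult[OF \<gamma>])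
    have fk: "fourier ?k y = \<Gamma> (x + y)" for y
      unfolding \<Gamma>_def fourier_def
      by (rule Bochner_Integration.integral_cong)
         (simp_all add: inner_add_right ring_distribs exp_diff exp_minus exp_add inner_commute field_simps)
    have int: "integrable lborel (\<lambda>y. ?f' y * \<Gamma> (x + y))"
    proof (rule Bochner_Integration.integrable_bound[OF integrable_mult_right[OF f', of "L1_norm \<gamma>"]])
      show "AE y in lborel. norm (?f' y * \<Gamma> (x + y)) \<le> norm (complex_of_real (L1_norm \<gamma>) * ?f' y)"
        unfolding \<Gamma>_def norm_mult
        by (rule AE_I2, subst mult.commute)
           (auto intro!: mult_right_mono order_trans[OF norm_fourier_le] abs_ge_self)
      have [measurable]: "\<Gamma> \<in> borel_measurable borel" using \<Gamma> by simp
      show "(\<lambda>y. ?f' y * \<Gamma> (x + y)) \<in> borel_measurable lborel" by measurable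
    qed
    have "fourier h x = (\<integral>\<xi>. fourier ?f' \<xi> * ?k \<xi> \<partial>lborel)"
      unfolding fourier_def[of h] h_def cnj_fourier[OF f] by (simp add: mult_ac)
    also have "\<dots> = (\<integral>y. ?f' y * fourier ?k y \<partial>lborel)" by (rule integral_fourier_mult[OF f' k])
    also have "\<dots> = (\<integral>y. ?f' y * \<Gamma> (x + y) \<partial>lborel)" by (simp only: fk)
    also have "\<dots> = (\<integral>z. ?f' (z - x) * \<Gamma> (x + (z - x)) \<partial>lborel)" by (rule integral_translate[OF int, symmetric])
    also have "\<dots> = (\<integral>z. \<Gamma> z * cnj (f (x - z)) \<partial>lborel)" by (simp add: mult.commute)
    finally show ?thesis .
  qed
  let ?F = "\<lambda>z x. \<Gamma> z * (f x * cnj (f (x - z)))"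
  have [measurable]: "\<Gamma> \<in> borel_measurable borel" using \<Gamma> by simp
  have F: "integrable (lborel \<Otimes>\<^sub>M lborel) (\<lambda>(z, x). ?F z x)"
  proof (rule lborel_pair.Fubini_integrable)
    show "(\<lambda>(z, x). ?F z x) \<in> borel_measurable (lborel \<Otimes>\<^sub>M lborel)" by measurable
    have "integrable lborel (\<lambda>z. LINT x|lborel. norm (?F z x))"
    proof (rule Bochner_Integration.integrable_bound[OF integrable_mult_right[OF integrable_norm[OF \<Gamma>], of "\<integral>x. (cmod (f x))\<^sup>2 \<partial>lborel"]])
      show "(\<lambda>z. LINT x|lborel. norm (?F z x)) \<in> borel_measurable lborel" by measurable
      show "AE z in lborel. norm (LINT x|lborel. norm (?F z x)) \<le> norm ((\<integral>x. (cmod (f x))\<^sup>2 \<partial>lborel) * norm (\<Gamma> z))"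
      proof (rule AE_I2)
        fix z
        have "(LINT x|lborel. norm (?F z x)) = norm (\<Gamma> z) * (\<integral>x. cmod (f x * cnj (f (x - z))) \<partial>lborel)"
          unfolding norm_mult[of "\<Gamma> z"] by simp
        also have "\<dots> \<le> norm (\<Gamma> z) * (\<integral>x. (cmod (f x))\<^sup>2 \<partial>lborel)"
          by (intro mult_left_mono integral_norm_autocorrelation f2) simp
        finally show "norm (LINT x|lborel. norm (?F z x)) \<le> norm ((\<integral>x. (cmod (f x))\<^sup>2 \<partial>lborel) * norm (\<Gamma> z))"
          by (simp add: mult.commute abs_mult)
      qed
    qed
    then show "integrable lborel (\<lambda>z. LINT x|lborel. norm (case (z, x) of (z, x) \<Rightarrow> ?F z x))" by simp
    show "AE z in lborel. integrable lborel (\<lambda>x. case (z, x) of (z, x) \<Rightarrow> ?F z x)"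
      using integrable_autocorrelation[OF f2] by simp
  qed
  have "complex_of_real (\<integral>\<xi>. (cmod (fourier f \<xi>))\<^sup>2 * exp (- (norm (\<delta> *\<^sub>R \<xi>))\<^sup>2 / 2) \<partial>lborel)
     = (\<integral>\<xi>. fourier f \<xi> * h \<xi> \<partial>lborel)"
    unfolding h_eq by (rule integral_complex_of_real[symmetric])
  also have "\<dots> = (\<integral>x. f x * fourier h x \<partial>lborel)" by (rule integral_fourier_mult[OF f h])
  also have "\<dots> = (\<integral>x. (\<integral>z. ?F z x \<partial>lborel) \<partial>lborel)"
    unfolding fourier_h by (simp add: mult.left_commute flip: integral_mult_right_zero)
  also have "\<dots> = (\<integral>z. (\<integral>x. ?F z x \<partial>lborel) \<partial>lborel)" by (rule lborel_pair.Fubini_integral[OF F])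
  also have "\<dots> = (\<integral>z. \<Gamma> z * autocorrelation f z \<partial>lborel)" by (simp add: autocorrelation_def)
  also have "\<dots> = (\<bar>\<delta>\<bar> ^ DIM(real ^ 'n)) *\<^sub>R
      (\<integral>s. \<Gamma> (0 + \<delta> *\<^sub>R s) * autocorrelation f (0 + \<delta> *\<^sub>R s) \<partial>lborel)"
  proof (rule integral_euclidean_affine)
    show "integrable lborel (\<lambda>z. \<Gamma> z * autocorrelation f z)"
      using lborel_pair.integrable_fst'[OF F] by (simp add: autocorrelation_def)
  qed (use \<delta> in simp)
  also have "\<dots> = (\<integral>s. (complex_of_real (\<delta> ^ CARD('n)) * \<Gamma> (\<delta> *\<^sub>R s)) * autocorrelation f (\<delta> *\<^sub>R s) \<partial>lborel)"
    using \<delta> by (simp add: scaleR_conv_of_real[where 'a = complex] mult.assoc)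
  also have "\<dots> = complex_of_real (sqrt (2 * pi) ^ CARD('n)) * (\<integral>s. gauss s * autocorrelation f (\<delta> *\<^sub>R s) \<partial>lborel)"
    unfolding \<Gamma>_scale by (simp add: mult.assoc)
  finally have *: "complex_of_real (\<integral>\<xi>. (cmod (fourier f \<xi>))\<^sup>2 * exp (- (norm (\<delta> *\<^sub>R \<xi>))\<^sup>2 / 2) \<partial>lborel)
     = complex_of_real (sqrt (2 * pi) ^ CARD('n)) * (\<integral>s. gauss s * autocorrelation f (\<delta> *\<^sub>R s) \<partial>lborel)" .
  have int: "integrable lborel (\<lambda>s. gauss s * autocorrelation f (\<delta> *\<^sub>R s))"
  proof (rule Bochner_Integration.integrable_bound[OF integrable_mult_right[OF integrable_gauss, of "complex_of_real (\<integral>x. (cmod (f x))\<^sup>2 \<partial>lborel)"]])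
    show "(\<lambda>s. gauss s * autocorrelation f (\<delta> *\<^sub>R s)) \<in> borel_measurable lborel"
      unfolding autocorrelation_def by measurable
    show "AE s in lborel. norm (gauss s * autocorrelation f (\<delta> *\<^sub>R s))
        \<le> norm (complex_of_real (\<integral>x. (cmod (f x))\<^sup>2 \<partial>lborel) * gauss s)"
      by (rule AE_I2) (auto simp: norm_mult mult.commute[of "cmod (gauss _)"] cmod_autocorrelation_le[OF f2]
          intro!: mult_right_mono)
  qed
  have "(\<integral>s. exp (- (norm s)\<^sup>2 / 2) * Re (autocorrelation f (\<delta> *\<^sub>R s)) \<partial>lborel)
     = Re (\<integral>s. gauss s * autocorrelation f (\<delta> *\<^sub>R s) \<partial>lborel)"
    using int by (subst integral_Re[symmetric]) (simp_all add: gauss_def)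
  then show ?E using arg_cong[OF *, of Re] by simp
qed


text \<open>In \<open>integral_fourier_sq_gauss\<close> let \<open>\<delta>\<close> tend to \<open>0\<close>. The left-hand side increases to the integral of
  \<open>\<bar>fourier f\<bar>\<^sup>2\<close>; its finiteness is part of the conclusion. On the right-hand side the autocorrelation
  tends to its value at the origin, the squared norm of \<open>f\<close>, and the two Gaussian integrals
  contribute \<open>(2 \<pi>)\<^sup>n\<close>.\<close>
theorem plancherel:
  fixes f :: "real ^ 'n::finite \<Rightarrow> complex"
  assumes f1: "f \<in> L1_space" and f2: "f \<in> L2_space"
  shows "L2_ennorm2 (fourier f) = ennreal ((2 * pi) ^ CARD('n) * (L2_norm f)\<^sup>2)"
proof -
  have [measurable]: "f \<in> borel_measurable borel" using f2 by (simp add: L2_space_iff)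
  define S where "S = (\<integral>x. (cmod (f x))\<^sup>2 \<partial>lborel)"
  have S0: "0 \<le> S" by (simp add: S_def)
  define \<delta> where "\<delta> k = 1 / (real k + 1)" for k :: nat
  have \<delta>: "0 < \<delta> k" for k by (simp add: \<delta>_def)
  have \<delta>0: "\<delta> \<longlonglongrightarrow> 0" unfolding \<delta>_def by real_asymp
  define G where "G k \<xi> = (cmod (fourier f \<xi>))\<^sup>2 * exp (- (norm (\<delta> k *\<^sub>R \<xi>))\<^sup>2 / 2)" for k \<xi>
  have G0: "0 \<le> G k \<xi>" for k \<xi> by (simp add: G_def)
  have Glim: "(\<lambda>k. G k \<xi>) \<longlonglongrightarrow> (cmod (fourier f \<xi>))\<^sup>2" for \<xi>
  proof -
    have "G k \<xi> = (cmod (fourier f \<xi>))\<^sup>2 * exp (- (\<delta> k * norm \<xi>)\<^sup>2 / 2)" for k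
      by (simp add: G_def power_mult_distrib)
    moreover have "(\<lambda>k. (cmod (fourier f \<xi>))\<^sup>2 * exp (- (\<delta> k * norm \<xi>)\<^sup>2 / 2))
        \<longlonglongrightarrow> (cmod (fourier f \<xi>))\<^sup>2 * exp (- (0 * norm \<xi>)\<^sup>2 / 2)"
      by (intro tendsto_intros \<delta>0) auto
    ultimately show ?thesis by simp
  qed
  have lim1: "(\<lambda>k. \<integral>\<^sup>+\<xi>. ennreal (G k \<xi>) \<partial>lborel) \<longlonglongrightarrow> L2_ennorm2 (fourier f)"
    unfolding L2_ennorm2_def
  proof (rule nn_integral_LIMSEQ)
    show "incseq (\<lambda>k \<xi>. ennreal (G k \<xi>))"
    proof (intro incseq_SucI le_funI ennreal_leI)
      fix k and \<xi> :: "real ^ 'n"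
      have "norm (\<delta> (Suc k) *\<^sub>R \<xi>) \<le> norm (\<delta> k *\<^sub>R \<xi>)"
        by (auto simp: \<delta>_def intro!: mult_right_mono divide_left_mono)
      then show "G k \<xi> \<le> G (Suc k) \<xi>"
        unfolding G_def by (intro mult_left_mono) (auto intro: power_mono)
    qed
    show "(\<lambda>\<xi>. ennreal (G k \<xi>)) \<in> borel_measurable lborel" for k
      unfolding G_def by measurable
    show "(\<lambda>k. ennreal (G k \<xi>)) \<longlonglongrightarrow> ennreal ((cmod (fourier f \<xi>))\<^sup>2)" for \<xi>
      by (intro tendsto_ennrealI Glim)
  qed
  let ?c = "sqrt (2 * pi) ^ CARD('n)"
  let ?R = "\<lambda>k s. exp (- (norm s)\<^sup>2 / 2) * Re (autocorrelation f (\<delta> k *\<^sub>R s))"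
  have eq: "(\<integral>\<^sup>+\<xi>. ennreal (G k \<xi>) \<partial>lborel) = ennreal (?c * (\<integral>s. ?R k s \<partial>lborel))" for k
    using integral_fourier_sq_gauss[OF f1 f2 \<delta>[of k]] G0 unfolding G_def
    by (subst nn_integral_eq_integral) auto
  have "(\<lambda>k. \<integral>s. ?R k s \<partial>lborel) \<longlonglongrightarrow> integral\<^sup>L lborel (\<lambda>s :: real ^ 'n. exp (- (norm s)\<^sup>2 / 2) * S)"
  proof (rule integral_dominated_convergence[where w = "\<lambda>s. exp (- (norm s)\<^sup>2 / 2) * S"])
    show "?R k \<in> borel_measurable lborel" for k unfolding autocorrelation_def by measurable
    show "integrable lborel (\<lambda>s :: real ^ 'n. exp (- (norm s)\<^sup>2 / 2) * S)"
      by (intro integrable_mult_left integrable_real_gauss)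
    show "AE s in lborel. norm (?R k s) \<le> exp (- (norm s)\<^sup>2 / 2) * S" for k
    proof (rule AE_I2)
      fix s :: "real ^ 'n"
      have "\<bar>Re (autocorrelation f (\<delta> k *\<^sub>R s))\<bar> \<le> S"
        unfolding S_def by (rule order_trans[OF abs_Re_le_cmod cmod_autocorrelation_le[OF f2]])
      then show "norm (?R k s) \<le> exp (- (norm s)\<^sup>2 / 2) * S" by (simp add: abs_mult)
    qed
    show "AE s in lborel. (\<lambda>k. ?R k s) \<longlonglongrightarrow> exp (- (norm s)\<^sup>2 / 2) * S"
    proof (rule AE_I2)
      fix s :: "real ^ 'n"
      have "(\<lambda>k. \<delta> k *\<^sub>R s) \<longlonglongrightarrow> 0" using tendsto_scaleR[OF \<delta>0 tendsto_const, of s] by simp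
      then have "(\<lambda>k. L2_ennorm2 (\<lambda>x. f x - f (x - \<delta> k *\<^sub>R s))) \<longlonglongrightarrow> ennreal 0"
        unfolding ennreal_0 by (rule L2_translation_continuous[OF f2])
      then have "(\<lambda>k. enn2real (L2_ennorm2 (\<lambda>x. f x - f (x - \<delta> k *\<^sub>R s)))) \<longlonglongrightarrow> 0"
        by (rule tendsto_enn2real) simp
      then have "(\<lambda>k. Re (autocorrelation f (\<delta> k *\<^sub>R s))) \<longlonglongrightarrow> S - 0 / 2"
        unfolding Re_autocorrelation[OF f2] S_def[symmetric]
        by (intro tendsto_diff tendsto_divide tendsto_const) auto
      then show "(\<lambda>k. ?R k s) \<longlonglongrightarrow> exp (- (norm s)\<^sup>2 / 2) * S" by (intro tendsto_mult_left) simp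
    qed
  qed simp
  then have "(\<lambda>k. ?c * (\<integral>s. ?R k s \<partial>lborel)) \<longlonglongrightarrow> ?c * (?c * S)"
    by (intro tendsto_mult_left) (simp only: integral_mult_left_zero integral_gauss)
  then have "(\<lambda>k. \<integral>\<^sup>+\<xi>. ennreal (G k \<xi>) \<partial>lborel) \<longlonglongrightarrow> ennreal (?c * (?c * S))"
    unfolding eq by (rule tendsto_ennrealI)
  then have "L2_ennorm2 (fourier f) = ennreal (?c * (?c * S))"
    using lim1 LIMSEQ_unique by blast
  moreover have "?c * (?c * S) = (2 * pi) ^ CARD('n) * S"
  proof -
    have "?c * ?c = (sqrt (2 * pi) * sqrt (2 * pi)) ^ CARD('n)" by (rule power_mult_distrib[symmetric])
    then show ?thesis by (simp add: mult.assoc[symmetric])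
  qed
  ultimately show ?thesis using S0 by (simp add: L2_norm_def S_def)
qed

lemma L2_norm_power2: "(L2_norm f)\<^sup>2 = (\<integral>x. (cmod (f x))\<^sup>2 \<partial>lborel)"
  by (simp add: L2_norm_def)

lemma L2_norm_nonneg: "0 \<le> L2_norm f"
  by (simp add: L2_norm_def)

lemma L2_norm_enn2real:
  assumes "f \<in> L2_space" shows "(L2_norm f)\<^sup>2 = enn2real (L2_ennorm2 f)"
  using assms by (simp add: L2_ennorm2_eq L2_norm_power2)

text \<open>The factor \<open>\<epsilon>\<close> in front of the fixed function \<open>b\<close> makes this inequality, once integrated, a
  substitute for Minkowski's inequality.\<close>
lemma cmod_power2_diff_le:
  assumes "0 < \<epsilon>"
  shows "\<bar>(cmod a)\<^sup>2 - (cmod b)\<^sup>2\<bar> \<le> \<epsilon> * (cmod b)\<^sup>2 + (1 + 1 / \<epsilon>) * (cmod (a - b))\<^sup>2"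
proof -
  let ?b = "cmod b" and ?d = "cmod (a - b)"
  have ab: "\<bar>cmod a - ?b\<bar> \<le> ?d" by (rule norm_triangle_ineq3)
  have "\<bar>(cmod a)\<^sup>2 - ?b\<^sup>2\<bar> = \<bar>cmod a - ?b\<bar> * (cmod a + ?b)"
    by (simp add: power2_eq_square square_diff_square_factored abs_mult)
  also have "\<dots> \<le> ?d * (2 * ?b + ?d)" by (intro mult_mono) (use ab in auto)
  also have "\<dots> = 2 * (?b * ?d) + ?d\<^sup>2" by (simp add: power2_eq_square algebra_simps)
  also have "2 * (?b * ?d) \<le> \<epsilon> * ?b\<^sup>2 + ?d\<^sup>2 / \<epsilon>"
    using sum_squares_bound[of "sqrt \<epsilon> * ?b" "?d / sqrt \<epsilon>"] assms
    by (simp add: power_mult_distrib power_divide)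
  finally show ?thesis by (simp add: algebra_simps)
qed

lemma L2_tendsto_imp_norm_tendsto:
  assumes F: "\<And>s. F s \<in> L2_space" and g: "g \<in> L2_space" and lim: "L2_tendsto F g \<F>"
  shows "((\<lambda>s. (L2_norm (F s))\<^sup>2) \<longlongrightarrow> (L2_norm g)\<^sup>2) \<F>"
proof -
  have Fm: "F s \<in> borel_measurable borel" and F2: "integrable lborel (\<lambda>x. (cmod (F s x))\<^sup>2)" for s
    using F[of s] by (auto simp: L2_space_def)
  have gm: "g \<in> borel_measurable borel" and g2: "integrable lborel (\<lambda>x. (cmod (g x))\<^sup>2)"
    using g by (auto simp: L2_space_def)
  define d where "d s = (\<integral>x. (cmod (F s x - g x))\<^sup>2 \<partial>lborel)" for s
  have d2: "integrable lborel (\<lambda>x. (cmod (F s x - g x))\<^sup>2)" for s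
  proof (rule Bochner_Integration.integrable_bound[OF
        Bochner_Integration.integrable_add[OF integrable_mult_right[OF F2, of 2] integrable_mult_right[OF g2, of 2]]])
    show "(\<lambda>x. (cmod (F s x - g x))\<^sup>2) \<in> borel_measurable lborel" using Fm[of s] gm by measurable
    show "AE x in lborel. norm ((cmod (F s x - g x))\<^sup>2) \<le> norm (2 * (cmod (F s x))\<^sup>2 + 2 * (cmod (g x))\<^sup>2)"
      using cmod_add_power2_le[of "F s _" "- g _"] by simp
  qed
  have "(\<integral>\<^sup>+x. ennreal ((cmod (F s x - g x))\<^sup>2) \<partial>lborel) = ennreal (d s)" for s
    unfolding d_def by (rule nn_integral_eq_integral[OF d2]) simp
  then have "((\<lambda>s. ennreal (d s)) \<longlongrightarrow> ennreal 0) \<F>" using lim by (simp add: L2_tendsto_def)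
  then have d0: "(d \<longlongrightarrow> 0) \<F>" by (subst (asm) tendsto_ennreal_iff) (auto simp: d_def)
  have key: "\<bar>(L2_norm (F s))\<^sup>2 - (L2_norm g)\<^sup>2\<bar> \<le> \<epsilon> * (L2_norm g)\<^sup>2 + (1 + 1 / \<epsilon>) * d s" if "0 < \<epsilon>" for \<epsilon> s
  proof -
    have "\<bar>(L2_norm (F s))\<^sup>2 - (L2_norm g)\<^sup>2\<bar> = \<bar>\<integral>x. (cmod (F s x))\<^sup>2 - (cmod (g x))\<^sup>2 \<partial>lborel\<bar>"
      using F2[of s] g2 by (simp add: L2_norm_power2)
    also have "\<dots> \<le> (\<integral>x. \<bar>(cmod (F s x))\<^sup>2 - (cmod (g x))\<^sup>2\<bar> \<partial>lborel)" by (rule integral_abs_bound)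
    also have "\<dots> \<le> (\<integral>x. \<epsilon> * (cmod (g x))\<^sup>2 + (1 + 1 / \<epsilon>) * (cmod (F s x - g x))\<^sup>2 \<partial>lborel)"
      by (intro integral_mono integrable_abs Bochner_Integration.integrable_diff
          Bochner_Integration.integrable_add integrable_mult_right F2 g2 d2 cmod_power2_diff_le that)
    also have "\<dots> = \<epsilon> * (L2_norm g)\<^sup>2 + (1 + 1 / \<epsilon>) * d s"
      using g2 d2[of s] by (simp add: L2_norm_power2 d_def)
    finally show ?thesis .
  qed
  show ?thesis
  proof (rule tendstoI)
    fix e :: real assume e: "0 < e"
    define \<epsilon> where "\<epsilon> = e / (2 * ((L2_norm g)\<^sup>2 + 1))"
    have pos: "0 < (L2_norm g)\<^sup>2 + 1" by (intro add_nonneg_pos) auto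
    have \<epsilon>: "0 < \<epsilon>" using e pos by (simp add: \<epsilon>_def)
    have "((\<lambda>s. (1 + 1 / \<epsilon>) * d s) \<longlongrightarrow> 0) \<F>" using tendsto_mult_left[OF d0] by simp
    then have "eventually (\<lambda>s. (1 + 1 / \<epsilon>) * d s < e / 2) \<F>" by (rule order_tendstoD) (use e in simp)
    then show "eventually (\<lambda>s. dist ((L2_norm (F s))\<^sup>2) ((L2_norm g)\<^sup>2) < e) \<F>"
    proof eventually_elim
      case (elim s)
      have "\<epsilon> * (L2_norm g)\<^sup>2 \<le> \<epsilon> * ((L2_norm g)\<^sup>2 + 1)" using \<epsilon> by (intro mult_left_mono) auto
      also have "\<dots> = e / 2" using pos by (simp add: \<epsilon>_def field_simps)
      finally show ?case using key[OF \<epsilon>, of s] elim unfolding dist_real_def by linarith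
    qed
  qed
qed

section \<open>The Fourier transform on \<open>L\<^sup>2\<close>\<close>

lemma truncation_L1_L2:
  assumes f: "f \<in> L2_space"
  shows "(\<lambda>x. indicator (cball 0 R) x * f x) \<in> L2_space"
    and "(\<lambda>x. indicator (cball 0 R) x * f x) \<in> L1_space"
proof -
  have fm[measurable]: "f \<in> borel_measurable borel" and f2: "integrable lborel (\<lambda>x. (cmod (f x))\<^sup>2)"
    using f by (auto simp: L2_space_def)
  have cb: "cball 0 R \<in> sets borel" by simp
  have m: "(\<lambda>x. indicator (cball 0 R) x * f x) \<in> borel_measurable borel"
    by (intro borel_measurable_times borel_measurable_indicator cb fm)
  show "(\<lambda>x. indicator (cball 0 R) x * f x) \<in> L2_space"
    unfolding L2_space_def
  proof (intro CollectI conjI Bochner_Integration.integrable_bound[OF f2])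
    show "AE x in lborel. norm ((cmod (indicator (cball 0 R) x * f x))\<^sup>2) \<le> norm ((cmod (f x))\<^sup>2)"
      by (rule AE_I2) (auto simp: norm_mult indicator_def)
  qed (use m in auto)
  have "integrable lborel (indicator (cball 0 R) :: real ^ 'a \<Rightarrow> real)"
    using emeasure_lborel_cball_finite[of 0 R] by (intro integrable_real_indicator) auto
  from Bochner_Integration.integrable_add[OF this f2]
  show "(\<lambda>x. indicator (cball 0 R) x * f x) \<in> L1_space"
    unfolding L1_space_def
  proof (intro CollectI, elim Bochner_Integration.integrable_bound)
    show "AE x in lborel. norm (indicator (cball 0 R) x * f x) \<le> norm (indicator (cball 0 R) x + (cmod (f x))\<^sup>2)"
    proof (rule AE_I2)
      fix x
      have "cmod (f x) \<le> 1 + (cmod (f x))\<^sup>2"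
        using sum_squares_bound[of 1 "cmod (f x)"] norm_ge_zero[of "f x"] unfolding power_one by linarith
      then show "norm (indicator (cball 0 R) x * f x) \<le> norm (indicator (cball 0 R) x + (cmod (f x))\<^sup>2)"
        by (auto simp: norm_mult indicator_def)
    qed
  qed (use m in auto)
qed

lemma truncation_norm_tendsto:
  assumes f: "f \<in> L2_space"
  shows "((\<lambda>R. (L2_norm (\<lambda>x. indicator (cball 0 R) x * f x))\<^sup>2) \<longlongrightarrow> (L2_norm f)\<^sup>2) at_top"
  unfolding L2_norm_power2
proof (rule integral_dominated_convergence_at_top[where w = "\<lambda>x. (cmod (f x))\<^sup>2"])
  have fm: "f \<in> borel_measurable borel" and f2: "integrable lborel (\<lambda>x. (cmod (f x))\<^sup>2)"
    using f by (auto simp: L2_space_def)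
  show "integrable lborel (\<lambda>x. (cmod (f x))\<^sup>2)" by (rule f2)
  show "(\<lambda>x. (cmod (f x))\<^sup>2) \<in> borel_measurable lborel" using fm by measurable
  show "(\<lambda>x. (cmod (indicator (cball 0 R) x * f x))\<^sup>2) \<in> borel_measurable lborel" for R
    using truncation_L1_L2(1)[OF f, of R] by (auto simp: L2_space_def)
  show "\<forall>\<^sub>F R in at_top. AE x in lborel. norm ((cmod (indicator (cball 0 R) x * f x))\<^sup>2) \<le> (cmod (f x))\<^sup>2"
    by (rule always_eventually) (auto simp: norm_mult indicator_def)
  show "AE x in lborel. ((\<lambda>R. (cmod (indicator (cball 0 R) x * f x))\<^sup>2) \<longlongrightarrow> (cmod (f x))\<^sup>2) at_top"
  proof (rule AE_I2, rule tendsto_eventually)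
    fix x :: "real ^ 'a"
    show "\<forall>\<^sub>F R in at_top. (cmod (indicator (cball 0 R) x * f x))\<^sup>2 = (cmod (f x))\<^sup>2"
      using eventually_ge_at_top[of "norm x"] by eventually_elim simp
  qed
qed


theorem has_fourier_L2_plancherel:
  fixes f g :: "real ^ 'n::finite \<Rightarrow> complex"
  assumes "has_fourier_L2 f g"
  shows "(L2_norm g)\<^sup>2 = (2 * pi) ^ CARD('n) * (L2_norm f)\<^sup>2"
proof -
  let ?f = "\<lambda>R::real. \<lambda>x. indicator (cball 0 R) x * f x"
  have f: "f \<in> L2_space" and g: "g \<in> L2_space" and lim: "L2_tendsto (\<lambda>R. fourier (?f R)) g at_top"
    using assms unfolding has_fourier_L2_def by blast+
  note pl = plancherel[OF truncation_L1_L2(2)[OF f] truncation_L1_L2(1)[OF f]]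
  have F: "fourier (?f R) \<in> L2_space" for R
  proof -
    have "?f R \<in> borel_measurable borel" using truncation_L1_L2(1)[OF f, of R] by (simp add: L2_space_iff)
    then show ?thesis using pl[of R] by (simp add: L2_space_iff)
  qed
  have "(L2_norm (fourier (?f R)))\<^sup>2 = (2 * pi) ^ CARD('n) * (L2_norm (?f R))\<^sup>2" for R
    using pl[of R] by (simp add: L2_norm_enn2real[OF F])
  with L2_tendsto_imp_norm_tendsto[OF F g lim]
  have "((\<lambda>R. (2 * pi) ^ CARD('n) * (L2_norm (?f R))\<^sup>2) \<longlongrightarrow> (L2_norm g)\<^sup>2) at_top" by simp
  moreover have "((\<lambda>R. (2 * pi) ^ CARD('n) * (L2_norm (?f R))\<^sup>2)
      \<longlongrightarrow> (2 * pi) ^ CARD('n) * (L2_norm f)\<^sup>2) at_top"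
    by (intro tendsto_mult_left truncation_norm_tendsto f)
  ultimately show ?thesis by (rule tendsto_unique[OF trivial_limit_at_top_linorder])
qed

text \<open>The transforms of the truncations converge pointwise to the Fourier integral and in \<open>L\<^sup>2\<close> to \<open>g\<close>. By
  Fatou's lemma the two limits agree.\<close>
lemma has_fourier_L2_eq_fourier:
  fixes f g :: "real ^ 'n::finite \<Rightarrow> complex"
  assumes fg: "has_fourier_L2 f g" and f1: "f \<in> L1_space"
  shows "AE \<xi> in lborel. g \<xi> = fourier f \<xi>"
proof -
  let ?f = "\<lambda>k::nat. \<lambda>x. indicator (cball 0 (real k)) x * f x"
  have f: "f \<in> L2_space" and g: "g \<in> L2_space"
    and lim: "L2_tendsto (\<lambda>R::real. fourier (\<lambda>x. indicator (cball 0 R) x * f x)) g at_top"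
    using fg unfolding has_fourier_L2_def by blast+
  have fm[measurable]: "f \<in> borel_measurable borel" and gm[measurable]: "g \<in> borel_measurable borel"
    using f g by (auto simp: L2_space_iff)
  have fi: "integrable lborel f" using f1 by (simp add: L1_space_def)
  have fkm[measurable]: "?f k \<in> borel_measurable borel" for k
    using truncation_L1_L2(1)[OF f, of "real k"] by (simp add: L2_space_iff)
  have lim_seq: "(\<lambda>k. L2_ennorm2 (\<lambda>\<xi>. fourier (?f k) \<xi> - g \<xi>)) \<longlonglongrightarrow> 0"
    using filterlim_compose[OF lim[unfolded L2_tendsto_def] filterlim_real_sequentially]
    by (simp add: L2_ennorm2_def)
  have pointwise: "(\<lambda>k. fourier (?f k) \<xi>) \<longlonglongrightarrow> fourier f \<xi>" for \<xi>
    unfolding fourier_def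
  proof (rule integral_dominated_convergence[where w = "\<lambda>x. cmod (f x)"])
    let ?e = "\<lambda>x. exp (- (\<i> * complex_of_real (x \<bullet> \<xi>)))"
    show "(\<lambda>x. ?e x * f x) \<in> borel_measurable lborel" by measurable
    show "(\<lambda>x. ?e x * ?f k x) \<in> borel_measurable lborel" for k by measurable
    show "AE x in lborel. (\<lambda>k. ?e x * ?f k x) \<longlonglongrightarrow> ?e x * f x"
    proof (rule AE_I2, rule tendsto_eventually)
      fix x :: "real ^ 'n"
      obtain k0 :: nat where "norm x \<le> real k0" using real_arch_simple by blast
      then show "\<forall>\<^sub>F k in sequentially. ?e x * ?f k x = ?e x * f x"
        unfolding eventually_sequentially by (intro exI[of _ k0]) auto
    qed
    show "AE x in lborel. cmod (?e x * ?f k x) \<le> cmod (f x)" for k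
      by (rule AE_I2) (auto simp: norm_mult indicator_def)
  qed (use fi in simp)
  have "L2_ennorm2 (\<lambda>\<xi>. fourier f \<xi> - g \<xi>)
      = (\<integral>\<^sup>+\<xi>. liminf (\<lambda>k. ennreal ((cmod (fourier (?f k) \<xi> - g \<xi>))\<^sup>2)) \<partial>lborel)"
    unfolding L2_ennorm2_def
  proof (rule nn_integral_cong)
    fix \<xi>
    have "(\<lambda>k. ennreal ((cmod (fourier (?f k) \<xi> - g \<xi>))\<^sup>2)) \<longlonglongrightarrow> ennreal ((cmod (fourier f \<xi> - g \<xi>))\<^sup>2)"
      by (intro tendsto_ennrealI tendsto_intros pointwise)
    then show "ennreal ((cmod (fourier f \<xi> - g \<xi>))\<^sup>2) = liminf (\<lambda>k. ennreal ((cmod (fourier (?f k) \<xi> - g \<xi>))\<^sup>2))"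
      by (rule lim_imp_Liminf[OF sequentially_bot, symmetric])
  qed
  also have "\<dots> \<le> liminf (\<lambda>k. L2_ennorm2 (\<lambda>\<xi>. fourier (?f k) \<xi> - g \<xi>))"
    unfolding L2_ennorm2_def by (rule nn_integral_liminf) measurable
  also have "\<dots> = 0" using lim_imp_Liminf[OF sequentially_bot lim_seq] by simp
  finally have "(\<integral>\<^sup>+\<xi>. ennreal ((cmod (fourier f \<xi> - g \<xi>))\<^sup>2) \<partial>lborel) = 0" by (simp add: L2_ennorm2_def)
  then have "AE \<xi> in lborel. ennreal ((cmod (fourier f \<xi> - g \<xi>))\<^sup>2) = 0"
    by (subst (asm) nn_integral_0_iff_AE) auto
  then show ?thesis by eventually_elim simp
qed

section \<open>The damped oscillator\<close>

lemma linear_ode_solution: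
  fixes p :: "real \<Rightarrow> complex" and k :: complex
  assumes p: "\<And>t. t \<ge> 0 \<Longrightarrow> (p has_vector_derivative k * p t) (at t within {0..})" and "t \<ge> 0"
  shows "p t = exp (k * complex_of_real t) * p 0"
proof -
  let ?q = "\<lambda>t. exp (t *\<^sub>R (- k)) * p t"
  have "(?q has_vector_derivative 0) (at s within {0..})" if "s \<in> {0..}" for s
  proof -
    have "(?q has_vector_derivative (exp (s *\<^sub>R (- k)) * (k * p s) + exp (s *\<^sub>R (- k)) * (- k) * p s)) (at s within {0..})"
      by (rule has_vector_derivative_mult[OF exp_scaleR_has_vector_derivative_right p]) (use that in simp)
    then show ?thesis by (simp add: algebra_simps)
  qed
  then obtain c where c: "\<And>s. s \<in> {0..} \<Longrightarrow> ?q s = c"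
    using has_vector_derivative_zero_constant[OF convex_real_interval(1), of 0 ?q] by blast
  have "?q t = p 0" using c[of t] c[of 0] \<open>t \<ge> 0\<close> by simp
  moreover have "exp (k * complex_of_real t) * ?q t = p t"
  proof -
    have "exp (k * complex_of_real t) * exp (t *\<^sub>R (- k)) = exp (k * complex_of_real t + t *\<^sub>R (- k))"
      by (rule exp_add[symmetric])
    also have "k * complex_of_real t + t *\<^sub>R (- k) = 0" by (simp add: scaleR_conv_of_real)
    finally show ?thesis by (simp add: mult.assoc[symmetric])
  qed
  ultimately show ?thesis by simp
qed

text \<open>If \<open>l\<close> and \<open>cnj l\<close> are the characteristic roots \<open>- a \<plusminus> \<i> b\<close>, then \<open>w' - cnj l w\<close> solves the first order
  equation with coefficient \<open>l\<close>. Doing this for both roots determines \<open>(l - cnj l) w = 2 \<i> b w\<close>.\<close>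
lemma damped_oscillator_solution:
  fixes w w' w'' :: "real \<Rightarrow> complex" and a b :: real
  assumes b: "b \<noteq> 0"
    and w: "\<And>t. t \<ge> 0 \<Longrightarrow> (w has_vector_derivative w' t) (at t within {0..})"
    and w': "\<And>t. t \<ge> 0 \<Longrightarrow> (w' has_vector_derivative w'' t) (at t within {0..})"
    and ode: "\<And>t. t \<ge> 0 \<Longrightarrow> w'' t + complex_of_real (2 * a) * w' t + complex_of_real (a\<^sup>2 + b\<^sup>2) * w t = 0"
    and t: "t \<ge> 0"
  shows "w t = complex_of_real (exp (- (a * t))) *
    (complex_of_real (cos (b * t)) * w 0 + complex_of_real (sin (b * t) / b) * (w' 0 + complex_of_real a * w 0))"
proof -
  have factor: "w' t - cnj l * w t = exp (l * complex_of_real t) * (w' 0 - cnj l * w 0)"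
    if l: "l + cnj l = - complex_of_real (2 * a)" "l * cnj l = complex_of_real (a\<^sup>2 + b\<^sup>2)" for l
  proof (rule linear_ode_solution[OF _ t])
    fix s :: real assume s: "s \<ge> 0"
    have "((\<lambda>s. w' s - cnj l * w s) has_vector_derivative (w'' s - cnj l * w' s)) (at s within {0..})"
      by (intro has_vector_derivative_diff has_vector_derivative_mult_right w w' s)
    also have "w'' s = - complex_of_real (2 * a) * w' s - complex_of_real (a\<^sup>2 + b\<^sup>2) * w s"
      using ode[OF s] by (simp add: algebra_simps add_eq_0_iff2)
    also have "\<dots> - cnj l * w' s = l * (w' s - cnj l * w s)"
      unfolding l[symmetric] by (simp add: algebra_simps)
    finally show "((\<lambda>s. w' s - cnj l * w s) has_vector_derivative l * (w' s - cnj l * w s)) (at s within {0..})" .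
  qed
  let ?l = "Complex (- a) b"
  have l: "?l + cnj ?l = - complex_of_real (2 * a)" "?l * cnj ?l = complex_of_real (a\<^sup>2 + b\<^sup>2)"
    by (simp_all add: complex_eq_iff power2_eq_square)
  have e1: "exp (?l * complex_of_real t) = complex_of_real (exp (- (a * t))) * (complex_of_real (cos (b * t)) + \<i> * complex_of_real (sin (b * t)))"
    by (simp add: complex_eq_iff Re_exp Im_exp)
  have e2: "exp (cnj ?l * complex_of_real t) = complex_of_real (exp (- (a * t))) * (complex_of_real (cos (b * t)) - \<i> * complex_of_real (sin (b * t)))"
    by (simp add: complex_eq_iff Re_exp Im_exp)
  have "w' t - cnj ?l * w t = exp (?l * complex_of_real t) * (w' 0 - cnj ?l * w 0)"
    by (rule factor[OF l])
  moreover have "w' t - ?l * w t = exp (cnj ?l * complex_of_real t) * (w' 0 - ?l * w 0)"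
    using factor[of "cnj ?l"] l by (simp add: add.commute mult.commute)
  moreover have "(?l - cnj ?l) * w t = (w' t - cnj ?l * w t) - (w' t - ?l * w t)"
    by (simp add: algebra_simps)
  ultimately have "(?l - cnj ?l) * w t = exp (?l * complex_of_real t) * (w' 0 - cnj ?l * w 0)
      - exp (cnj ?l * complex_of_real t) * (w' 0 - ?l * w 0)"
    by simp
  also have "\<dots> = 2 * \<i> * complex_of_real b * (complex_of_real (exp (- (a * t))) *
    (complex_of_real (cos (b * t)) * w 0 + complex_of_real (sin (b * t) / b) * (w' 0 + complex_of_real a * w 0)))"
    unfolding e1 e2 using b by (simp add: complex_eq_iff field_simps)
  finally have "2 * \<i> * complex_of_real b * w t = 2 * \<i> * complex_of_real b * (complex_of_real (exp (- (a * t))) *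
    (complex_of_real (cos (b * t)) * w 0 + complex_of_real (sin (b * t) / b) * (w' 0 + complex_of_real a * w 0)))"
    by (simp add: complex_eq_iff)
  then show ?thesis using b by simp
qed

section \<open>Damping and frequency of the Fourier modes\<close>

definition damping :: "real \<Rightarrow> real ^ 'n::finite \<Rightarrow> real" where
  "damping \<mu> \<xi> = \<mu> / 2 * L_symbol \<xi>"

definition frequency :: "real \<Rightarrow> real ^ 'n::finite \<Rightarrow> real" where
  "frequency \<mu> \<xi> = sqrt ((norm \<xi>)\<^sup>2 - (damping \<mu> \<xi>)\<^sup>2)"

lemma damping_bounds:
  assumes "0 < \<mu>"
  shows "0 \<le> damping \<mu> \<xi>" and "damping \<mu> \<xi> \<le> \<mu> / 2 * norm \<xi>"
proof -
  have "ln (1 + norm \<xi>) \<le> norm \<xi>" by (rule ln_add_one_self_le_self) simp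
  then show "damping \<mu> \<xi> \<le> \<mu> / 2 * norm \<xi>"
    unfolding damping_def L_symbol_def using assms by (intro mult_left_mono) auto
  show "0 \<le> damping \<mu> \<xi>" using assms by (simp add: damping_def L_symbol_def)
qed

lemma frequency_bounds:
  assumes "0 < \<mu>" "\<mu> < 2"
  shows "sqrt (1 - (\<mu> / 2)\<^sup>2) * norm \<xi> \<le> frequency \<mu> \<xi>" and "frequency \<mu> \<xi> \<le> norm \<xi>"
    and "(damping \<mu> \<xi>)\<^sup>2 + (frequency \<mu> \<xi>)\<^sup>2 = (norm \<xi>)\<^sup>2"
proof -
  have sq: "(damping \<mu> \<xi>)\<^sup>2 \<le> (\<mu> / 2)\<^sup>2 * (norm \<xi>)\<^sup>2"
    using power_mono[OF damping_bounds(2,1)[of \<mu> \<xi>], of 2] assms by (simp only: power_mult_distrib)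
  have "sqrt (1 - (\<mu> / 2)\<^sup>2) * norm \<xi> = sqrt ((1 - (\<mu> / 2)\<^sup>2) * (norm \<xi>)\<^sup>2)"
    by (simp add: real_sqrt_mult)
  also have "\<dots> \<le> frequency \<mu> \<xi>"
    unfolding frequency_def using sq by (intro real_sqrt_le_mono) (simp add: algebra_simps)
  finally show "sqrt (1 - (\<mu> / 2)\<^sup>2) * norm \<xi> \<le> frequency \<mu> \<xi>" .
  show "frequency \<mu> \<xi> \<le> norm \<xi>"
    unfolding frequency_def by (rule real_le_lsqrt) auto
  have "(\<mu> / 2)\<^sup>2 \<le> 1" using assms by (intro power_le_one) auto
  then have "(\<mu> / 2)\<^sup>2 * (norm \<xi>)\<^sup>2 \<le> 1 * (norm \<xi>)\<^sup>2" by (intro mult_right_mono) auto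
  then show "(damping \<mu> \<xi>)\<^sup>2 + (frequency \<mu> \<xi>)\<^sup>2 = (norm \<xi>)\<^sup>2"
    unfolding frequency_def using sq by simp
qed

lemma damping_ratio_pos: "0 < \<mu> \<Longrightarrow> \<mu> < 2 \<Longrightarrow> 0 < 1 - (\<mu> / 2)\<^sup>2" for \<mu> :: real
  using power_strict_mono[of "\<mu> / 2" 1 2] by simp

text \<open>In the application \<open>P\<close> is the transform of \<open>u1\<close> at the origin and \<open>r = norm \<xi>\<close>. The factor \<open>1 / b\<close> is
  of order \<open>1 / r\<close>, but it only meets quantities of order \<open>r\<close>: the damping \<open>a\<close> and the difference
  \<open>w1 - P\<close>.\<close>
lemma oscillator_remainder:
  fixes a b t r \<kappa> M0 M1 :: real and w0 w1 P :: complex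
  assumes r: "0 < r" and \<kappa>: "0 < \<kappa>" and a: "0 \<le> a" "a \<le> r" and b: "\<kappa> * r \<le> b"
    and w0: "cmod w0 \<le> M0" and w1: "cmod (w1 - P) \<le> r * M1"
  shows "cmod (complex_of_real (cos (b * t)) * w0 + complex_of_real (sin (b * t) / b) * (w1 + complex_of_real a * w0)
            - complex_of_real (sin (b * t) / b) * P) \<le> (1 + 1 / \<kappa>) * (M0 + M1)"
proof -
  have M: "0 \<le> M0" "0 \<le> M1"
    using order_trans[OF norm_ge_zero w0] order_trans[OF norm_ge_zero w1] r by (auto simp: zero_le_mult_iff)
  have kr: "0 < \<kappa> * r" using r \<kappa> by simp
  then have b0: "0 < b" using b by linarith
  have s: "\<bar>sin (b * t) / b\<bar> \<le> 1 / (\<kappa> * r)"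
    using b0 kr b by (auto simp: abs_divide intro!: frac_le)
  have "complex_of_real (cos (b * t)) * w0 + complex_of_real (sin (b * t) / b) * (w1 + complex_of_real a * w0)
            - complex_of_real (sin (b * t) / b) * P
     = complex_of_real (cos (b * t)) * w0 + complex_of_real (sin (b * t) / b) * (w1 - P)
        + complex_of_real (sin (b * t) / b) * (complex_of_real a * w0)"
    by algebra
  also have "cmod \<dots> \<le> cmod (complex_of_real (cos (b * t)) * w0) + cmod (complex_of_real (sin (b * t) / b) * (w1 - P))
        + cmod (complex_of_real (sin (b * t) / b) * (complex_of_real a * w0))"
    by (intro order_trans[OF norm_triangle_ineq] add_right_mono norm_triangle_ineq)
  also have "\<dots> \<le> 1 * M0 + 1 / (\<kappa> * r) * (r * M1) + 1 / (\<kappa> * r) * (r * M0)"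
    unfolding norm_mult norm_of_real
    by (intro add_mono mult_mono s w0 w1) (use a r M kr in auto)
  also have "\<dots> = M0 + (M0 + M1) / \<kappa>" using r \<kappa> by (simp add: field_simps)
  also have "\<dots> \<le> (1 + 1 / \<kappa>) * (M0 + M1)" using M by (simp add: algebra_simps add_divide_distrib)
  finally show ?thesis .
qed

text \<open>The difference of the exponential from \<open>1\<close> costs a factor \<open>norm x * norm \<xi>\<close>, which the weight of
  the \<open>L\<^sup>1\<^sup>,\<^sup>1\<close> norm absorbs.\<close>
lemma fourier_minus_integral_le:
  fixes f :: "real ^ 'n::finite \<Rightarrow> complex"
  assumes f: "f \<in> L11_space"
  shows "cmod (fourier f \<xi> - (\<integral>x. f x \<partial>lborel)) \<le> norm \<xi> * L11_norm f"
proof -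
  have f1: "integrable lborel f" and f11: "integrable lborel (\<lambda>x. (1 + norm x) * cmod (f x))"
    using f by (auto simp: L11_space_def L1_space_def)
  let ?e = "\<lambda>x. exp (- (\<i> * complex_of_real (x \<bullet> \<xi>)))"
  have "fourier f \<xi> - (\<integral>x. f x \<partial>lborel) = (\<integral>x. ?e x * f x - f x \<partial>lborel)"
    unfolding fourier_def using f1 integrable_fourier_kernel_mult[OF f1, of \<xi>] by simp
  also have "cmod \<dots> \<le> (\<integral>x. cmod (?e x * f x - f x) \<partial>lborel)" by (rule integral_norm_bound)
  also have "\<dots> \<le> (\<integral>x. norm \<xi> * ((1 + norm x) * cmod (f x)) \<partial>lborel)"
  proof (rule integral_mono)
    show "integrable lborel (\<lambda>x. cmod (?e x * f x - f x))"
      by (intro integrable_norm Bochner_Integration.integrable_diff integrable_fourier_kernel_mult f1)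
    show "integrable lborel (\<lambda>x. norm \<xi> * ((1 + norm x) * cmod (f x)))"
      by (rule integrable_mult_right[OF f11])
    fix x
    have "cmod (?e x - 1) \<le> \<bar>x \<bullet> \<xi>\<bar>"
      using iexp_approx1[of "- (x \<bullet> \<xi>)" 0] by simp
    also have "\<dots> \<le> norm x * norm \<xi>" by (rule Cauchy_Schwarz_ineq2)
    also have "\<dots> \<le> (1 + norm x) * norm \<xi>" by (intro mult_right_mono) auto
    finally have "cmod (?e x - 1) * cmod (f x) \<le> (1 + norm x) * norm \<xi> * cmod (f x)"
      by (intro mult_right_mono) auto
    moreover have "?e x * f x - f x = (?e x - 1) * f x" by (simp add: left_diff_distrib)
    ultimately show "cmod (?e x * f x - f x) \<le> norm \<xi> * ((1 + norm x) * cmod (f x))"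
      by (simp only: norm_mult mult_ac)
  qed
  also have "\<dots> = norm \<xi> * L11_norm f" by (simp add: L11_norm_def)
  finally show ?thesis .
qed

lemma sin_ge_half: "0 \<le> x \<Longrightarrow> x \<le> 1 \<Longrightarrow> x / 2 \<le> sin x" for x :: real
proof -
  assume x: "0 \<le> x" "x \<le> 1"
  have "\<bar>sin x - x\<bar> \<le> x\<^sup>2 / 2"
    using Maclaurin_sin_bound[of x 2] by (simp add: lessThan_nat_numeral sin_coeff_def fact_numeral)
  moreover have "x\<^sup>2 \<le> x" using x by (simp add: power2_eq_square mult_left_le)
  ultimately show "x / 2 \<le> sin x" by linarith
qed

text \<open>The left-hand side is \<open>(1 + norm \<eta> / t) powr (- \<mu> t)\<close>. It decreases in \<open>t\<close> by concavity of the
  logarithm, hence is at most its value at \<open>t = 2 n / \<mu>\<close>, which is \<open>(1 + c norm \<eta>) powr (- 2 n)\<close>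
  with \<open>c = \<mu> / (2 n)\<close>. The exponent \<open>2 n\<close> is chosen to leave one square for each coordinate, so
  that the bound is a product of integrable functions of one variable.\<close>
lemma exp_damping_le:
  fixes \<eta> :: "real ^ 'n::finite"
  assumes \<mu>: "0 < \<mu>" and t: "2 * real CARD('n) / \<mu> \<le> t"
  shows "exp (- (2 * damping \<mu> ((1 / t) *\<^sub>R \<eta>) * t)) \<le> (\<Prod>i\<in>UNIV. inverse (1 + (\<mu> / (2 * real CARD('n)) * \<eta> $ i)\<^sup>2))"
proof -
  define N where "N = CARD('n)"
  have N: "0 < N" by (simp add: N_def)
  have t0: "0 < t" using assms N less_le_trans[of 0 "2 * real CARD('n) / \<mu>" t] by (simp add: N_def)
  define c where "c = \<mu> / (2 * real N)"
  have c: "0 < c" using \<mu> N by (simp add: c_def)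
  \<comment> \<open>\<open>\<theta>\<close> is the ratio of the smallest admissible time \<open>2 n / \<mu>\<close> to \<open>t\<close>.\<close>
  define \<theta> where "\<theta> = 2 * real N / (\<mu> * t)"
  have \<theta>: "0 < \<theta>" "\<theta> \<le> 1" using t t0 \<mu> N by (auto simp: \<theta>_def N_def field_simps)
  have "(1 - \<theta>) * ln 1 + \<theta> * ln (1 + c * norm \<eta>) \<le> ln ((1 - \<theta>) *\<^sub>R 1 + \<theta> *\<^sub>R (1 + c * norm \<eta>))"
    using \<theta> c by (intro concave_onD[OF ln_concave]) (auto intro: add_pos_nonneg)
  also have "(1 - \<theta>) *\<^sub>R 1 + \<theta> *\<^sub>R (1 + c * norm \<eta>) = 1 + norm \<eta> / t"
    using N \<mu> t0 by (simp add: \<theta>_def c_def field_simps)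
  finally have "\<mu> * t * (\<theta> * ln (1 + c * norm \<eta>)) \<le> \<mu> * t * ln (1 + norm \<eta> / t)"
    using \<mu> t0 by (intro mult_left_mono) auto
  moreover have "\<mu> * t * (\<theta> * ln (1 + c * norm \<eta>)) = 2 * real N * ln (1 + c * norm \<eta>)"
    using \<mu> t0 by (simp add: \<theta>_def)
  moreover have "2 * damping \<mu> ((1 / t) *\<^sub>R \<eta>) * t = \<mu> * t * ln (1 + norm \<eta> / t)"
    using t0 by (simp add: damping_def L_symbol_def)
  ultimately have "exp (- (2 * damping \<mu> ((1 / t) *\<^sub>R \<eta>) * t)) \<le> exp (- (2 * real N * ln (1 + c * norm \<eta>)))"
    by (simp only: exp_le_cancel_iff neg_le_iff_le)
  also have "\<dots> = inverse (((1 + c * norm \<eta>)\<^sup>2) ^ N)"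
  proof -
    have pos: "0 < 1 + c * norm \<eta>" using c by (intro add_pos_nonneg) auto
    have "2 * real N * ln (1 + c * norm \<eta>) = real (2 * N) * ln (1 + c * norm \<eta>)" by simp
    then show ?thesis using pos by (simp only: exp_minus exp_of_nat_mult exp_ln power_mult)
  qed
  also have "\<dots> \<le> inverse (\<Prod>i\<in>UNIV. 1 + (c * \<eta> $ i)\<^sup>2)"
  proof (rule le_imp_inverse_le)
    have "(\<Prod>i\<in>UNIV. 1 + (c * \<eta> $ i)\<^sup>2) \<le> (\<Prod>i\<in>(UNIV :: 'n set). (1 + c * norm \<eta>)\<^sup>2)"
    proof (rule prod_mono, rule conjI)
      fix i :: 'n
      have "(c * \<eta> $ i)\<^sup>2 \<le> (c * norm \<eta>)\<^sup>2"
        using c component_le_norm_cart[of \<eta> i] by (intro abs_le_square_iff[THEN iffD1]) (simp add: abs_mult)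
      also have "1 + (c * norm \<eta>)\<^sup>2 \<le> (1 + c * norm \<eta>)\<^sup>2"
        using c by (simp add: power2_sum)
      finally show "1 + (c * \<eta> $ i)\<^sup>2 \<le> (1 + c * norm \<eta>)\<^sup>2" by simp
    qed simp
    then show "(\<Prod>i\<in>UNIV. 1 + (c * \<eta> $ i)\<^sup>2) \<le> ((1 + c * norm \<eta>)\<^sup>2) ^ N" by (simp add: N_def)
    show "0 < (\<Prod>i\<in>UNIV. 1 + (c * \<eta> $ i)\<^sup>2)" by (intro prod_pos) (simp add: add_pos_nonneg)
  qed
  also have "\<dots> = (\<Prod>i\<in>UNIV. inverse (1 + (c * \<eta> $ i)\<^sup>2))" by (simp add: prod_inversef[symmetric] o_def)
  finally show ?thesis by (simp add: c_def N_def)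
qed

lemma integrable_inverse_one_plus_square:
  assumes "c \<noteq> 0"
  shows "integrable lborel (\<lambda>x::real. inverse (1 + (c * x)\<^sup>2))"
  using lborel_integrable_real_affine[OF _ assms, of "\<lambda>x. inverse (1 + x\<^sup>2)" 0] integrable_inverse_1_plus_square
  by (simp add: set_integrable_def einterval_def)

text \<open>After the substitution \<open>\<xi> = \<eta> / t\<close> the integrand has a majorant independent of \<open>t\<close>, and the
  Jacobian is the asserted power of \<open>t\<close>.\<close>
lemma nn_integral_damping_le:
  assumes \<mu>: "0 < \<mu>"
  shows "\<exists>J\<ge>0. \<forall>t\<ge>2 * real CARD('n) / \<mu>.
    (\<integral>\<^sup>+\<xi>. ennreal (exp (- (2 * damping \<mu> (\<xi> :: real ^ 'n::finite) * t))) \<partial>lborel) \<le> ennreal (J / t ^ CARD('n))"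
proof -
  let ?N = "CARD('n)"
  define g where "g \<eta> = (\<Prod>i\<in>UNIV. inverse (1 + (\<mu> / (2 * real ?N) * \<eta> $ i)\<^sup>2))" for \<eta> :: "real ^ 'n"
  define J where "J = (\<integral>\<eta>. g \<eta> \<partial>lborel)"
  have g: "integrable lborel g"
    unfolding g_def[abs_def] using \<mu> by (intro integrable_prod_vec integrable_inverse_one_plus_square) simp
  have g0: "0 \<le> g \<eta>" for \<eta> by (auto simp: g_def intro!: prod_nonneg)
  have "(\<integral>\<^sup>+\<xi>. ennreal (exp (- (2 * damping \<mu> (\<xi> :: real ^ 'n) * t))) \<partial>lborel) \<le> ennreal (J / t ^ ?N)"
    if t: "2 * real ?N / \<mu> \<le> t" for t
  proof -
    have t0: "0 < t" using \<mu> t less_le_trans[of 0 "2 * real ?N / \<mu>" t] by simp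
    have "(\<integral>\<^sup>+\<xi>. ennreal (exp (- (2 * damping \<mu> (\<xi> :: real ^ 'n) * t))) \<partial>lborel)
       = ennreal (\<bar>1 / t\<bar> ^ DIM(real ^ 'n)) *
         (\<integral>\<^sup>+\<eta>. ennreal (exp (- (2 * damping \<mu> (0 + (1 / t) *\<^sub>R \<eta> :: real ^ 'n) * t))) \<partial>lborel)"
    proof (rule nn_integral_euclidean_affine)
      show "(\<lambda>\<xi> :: real ^ 'n. ennreal (exp (- (2 * damping \<mu> \<xi> * t)))) \<in> borel_measurable borel"
        unfolding damping_def L_symbol_def by measurable
    qed (use t0 in simp)
    also have "\<dots> \<le> ennreal (\<bar>1 / t\<bar> ^ DIM(real ^ 'n)) * (\<integral>\<^sup>+\<eta>. ennreal (g \<eta>) \<partial>lborel)"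
      unfolding g_def add_0_left
      by (intro mult_left_mono nn_integral_mono ennreal_leI exp_damping_le \<mu> t) simp
    also have "(\<integral>\<^sup>+\<eta>. ennreal (g \<eta>) \<partial>lborel) = ennreal J"
      unfolding J_def using g g0 by (intro nn_integral_eq_integral) auto
    also have "ennreal (\<bar>1 / t\<bar> ^ DIM(real ^ 'n)) * ennreal J = ennreal (\<bar>1 / t\<bar> ^ DIM(real ^ 'n) * J)"
      by (rule ennreal_mult'[symmetric]) simp
    also have "\<bar>1 / t\<bar> ^ DIM(real ^ 'n) * J = J / t ^ ?N"
      using t0 by (simp add: power_one_over)
    finally show ?thesis .
  qed
  moreover have "0 \<le> J" unfolding J_def using g0 by simp
  ultimately show ?thesis by blast
qed

section \<open>Bounds for the solution on the Fourier side\<close>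

text \<open>The solution consists of the diffusive wave with mass \<open>P1\<close> and a remainder \<open>R\<close> that is bounded in time,
  both damped by the same exponential. At the null set \<open>\<xi> = 0\<close> both
  characteristic roots vanish and \<open>sin (b t) / b\<close> is \<open>0\<close> by convention instead of \<open>t\<close>.\<close>
lemma fourier_solution_profile:
  fixes u0 u1 :: "real ^ 'n::finite \<Rightarrow> complex"
  assumes \<mu>: "0 < \<mu>" "\<mu> < 2"
    and u0: "u0 \<in> L1_space" and u1: "u1 \<in> L11_space"
    and eq: "fourier_equation \<mu> u0 u1 u"
  defines "K \<equiv> 1 + 1 / sqrt (1 - (\<mu> / 2)\<^sup>2)"
  shows "\<exists>w. (\<forall>t\<ge>0. has_fourier_L2 (u t) (w t)) \<and>
    (AE \<xi> in lborel. 0 < norm \<xi> \<and> (\<forall>t\<ge>0. \<exists>R. cmod R \<le> K * (L1_norm u0 + L11_norm u1) \<and>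
       w t \<xi> = complex_of_real (exp (- (damping \<mu> \<xi> * t))) *
         (complex_of_real (sin (frequency \<mu> \<xi> * t) / frequency \<mu> \<xi>) * (\<integral>x. u1 x \<partial>lborel) + R)))"
proof -
  obtain w w' w'' where w: "\<And>t. t \<ge> 0 \<Longrightarrow> has_fourier_L2 (u t) (w t)"
    and w0: "has_fourier_L2 u0 (w 0)" and w1: "has_fourier_L2 u1 (w' 0)"
    and ode: "AE \<xi> in lborel. \<forall>t\<ge>0.
           ((\<lambda>s. w s \<xi>) has_vector_derivative w' t \<xi>) (at t within {0..}) \<and>
           ((\<lambda>s. w' s \<xi>) has_vector_derivative w'' t \<xi>) (at t within {0..}) \<and>
           w'' t \<xi> + complex_of_real (\<mu> * L_symbol \<xi>) * w' t \<xi>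
             + complex_of_real ((norm \<xi>)\<^sup>2) * w t \<xi> = 0"
    using eq unfolding fourier_equation_def by blast
  let ?P = "\<integral>x. u1 x \<partial>lborel"
  have \<kappa>: "0 < sqrt (1 - (\<mu> / 2)\<^sup>2)" using damping_ratio_pos[OF \<mu>] by simp
  have u1': "u1 \<in> L1_space" using u1 by (simp add: L11_space_def)
  have nz: "AE \<xi> :: real ^ 'n in lborel. \<xi> \<noteq> 0" by (rule AE_lborel_singleton)
  have "AE \<xi> in lborel. 0 < norm \<xi> \<and> (\<forall>t\<ge>0. \<exists>R. cmod R \<le> K * (L1_norm u0 + L11_norm u1) \<and>
       w t \<xi> = complex_of_real (exp (- (damping \<mu> \<xi> * t))) *
         (complex_of_real (sin (frequency \<mu> \<xi> * t) / frequency \<mu> \<xi>) * ?P + R))"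
    using ode nz has_fourier_L2_eq_fourier[OF w0 u0] has_fourier_L2_eq_fourier[OF w1 u1']
  proof eventually_elim
    case (elim \<xi>)
    let ?a = "damping \<mu> \<xi>" and ?b = "frequency \<mu> \<xi>"
    have r: "0 < norm \<xi>" using elim(2) by simp
    have a: "0 \<le> ?a" "?a \<le> norm \<xi>"
      using damping_bounds[OF \<mu>(1), of \<xi>] mult_right_mono[of "\<mu> / 2" 1 "norm \<xi>"] \<mu> by auto
    have b: "sqrt (1 - (\<mu> / 2)\<^sup>2) * norm \<xi> \<le> ?b" by (rule frequency_bounds(1)[OF \<mu>])
    then have b0: "?b \<noteq> 0" using \<kappa> r mult_pos_pos[OF \<kappa> r] by linarith
    have c0: "cmod (w 0 \<xi>) \<le> L1_norm u0" unfolding elim(3) by (rule norm_fourier_le)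
    have c1: "cmod (w' 0 \<xi> - ?P) \<le> norm \<xi> * L11_norm u1"
      unfolding elim(4) by (rule fourier_minus_integral_le[OF u1])
    show ?case
    proof (intro conjI allI impI)
      fix t :: real assume t: "0 \<le> t"
      let ?s = "complex_of_real (sin (?b * t) / ?b)"
      let ?R = "complex_of_real (cos (?b * t)) * w 0 \<xi> + ?s * (w' 0 \<xi> + complex_of_real ?a * w 0 \<xi>) - ?s * ?P"
      have ab: "2 * ?a = \<mu> * L_symbol \<xi>" by (simp add: damping_def)
      have "w t \<xi> = complex_of_real (exp (- (?a * t))) *
          (complex_of_real (cos (?b * t)) * w 0 \<xi> + ?s * (w' 0 \<xi> + complex_of_real ?a * w 0 \<xi>))"
        by (rule damped_oscillator_solution[OF b0 _ _ _ t, where w = "\<lambda>s. w s \<xi>" and w' = "\<lambda>s. w' s \<xi>" and w'' = "\<lambda>s. w'' s \<xi>"])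
           (use elim(1) in \<open>auto simp only: ab frequency_bounds(3)[OF \<mu>]\<close>)
      then have "w t \<xi> = complex_of_real (exp (- (?a * t))) * (?s * ?P + ?R)" by simp
      moreover have "cmod ?R \<le> K * (L1_norm u0 + L11_norm u1)"
        unfolding K_def by (rule oscillator_remainder[OF r \<kappa> a b c0 c1])
      ultimately show "\<exists>R. cmod R \<le> K * (L1_norm u0 + L11_norm u1) \<and>
         w t \<xi> = complex_of_real (exp (- (?a * t))) * (?s * ?P + R)" by blast
    qed (rule r)
  qed
  then show ?thesis using w by blast
qed

text \<open>As \<open>\<bar>sin (b t) / b\<bar> \<le> t\<close>, the bracket is at most \<open>cmod P * t + B\<close> uniformly in \<open>\<xi>\<close>, and the
  decay in \<open>t\<close> comes from the integral of the exponential alone.\<close>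
lemma L2_norm_fourier_upper:
  fixes w :: "real ^ 'n::finite \<Rightarrow> complex"
  assumes \<mu>: "0 < \<mu>" "\<mu> < 2" and w: "w \<in> L2_space" and t: "0 < t" and B: "0 \<le> B"
    and J: "0 \<le> J" "(\<integral>\<^sup>+\<xi>. ennreal (exp (- (2 * damping \<mu> (\<xi> :: real ^ 'n) * t))) \<partial>lborel) \<le> ennreal (J / t ^ CARD('n))"
    and prof: "AE \<xi> in lborel. 0 < norm \<xi> \<and> (\<exists>R. cmod R \<le> B \<and>
       w \<xi> = complex_of_real (exp (- (damping \<mu> \<xi> * t))) *
         (complex_of_real (sin (frequency \<mu> \<xi> * t) / frequency \<mu> \<xi>) * P + R))"
  shows "L2_norm w \<le> sqrt (J / t ^ CARD('n)) * (cmod P * t + B)"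
proof -
  let ?C = "cmod P * t + B"
  have C: "0 \<le> ?C" using t B by simp
  have "ennreal ((L2_norm w)\<^sup>2) = (\<integral>\<^sup>+\<xi>. ennreal ((cmod (w \<xi>))\<^sup>2) \<partial>lborel)"
    using L2_ennorm2_eq[OF w] by (simp add: L2_ennorm2_def L2_norm_power2)
  also have "\<dots> \<le> (\<integral>\<^sup>+\<xi>. ennreal (?C\<^sup>2) * ennreal (exp (- (2 * damping \<mu> (\<xi> :: real ^ 'n) * t))) \<partial>lborel)"
  proof (rule nn_integral_mono_AE)
    show "AE \<xi> in lborel. ennreal ((cmod (w \<xi>))\<^sup>2) \<le> ennreal (?C\<^sup>2) * ennreal (exp (- (2 * damping \<mu> \<xi> * t)))"
      using prof
    proof eventually_elim
      case (elim \<xi>)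
      let ?a = "damping \<mu> \<xi>" and ?b = "frequency \<mu> \<xi>"
      obtain R where R: "cmod R \<le> B"
        and weq: "w \<xi> = complex_of_real (exp (- (?a * t))) * (complex_of_real (sin (?b * t) / ?b) * P + R)"
        using elim by blast
      have b: "0 \<le> ?b" using frequency_bounds(1)[OF \<mu>, of \<xi>] damping_ratio_pos[OF \<mu>]
        by (meson mult_nonneg_nonneg norm_ge_zero order_trans real_sqrt_ge_zero less_imp_le)
      have "\<bar>sin (?b * t) / ?b\<bar> \<le> t"
        using abs_sin_x_le_abs_x[of "?b * t"] b t
        by (cases "?b = 0") (auto simp: abs_divide abs_mult divide_le_eq mult.commute)
      then have "cmod (complex_of_real (sin (?b * t) / ?b) * P + R) \<le> t * cmod P + B"
        by (intro order_trans[OF norm_triangle_ineq] add_mono R)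
           (simp only: norm_mult norm_of_real, intro mult_right_mono, auto)
      then have "cmod (w \<xi>) \<le> exp (- (?a * t)) * ?C"
        unfolding weq norm_mult norm_of_real by (simp add: mult.commute)
      then have "(cmod (w \<xi>))\<^sup>2 \<le> (exp (- (?a * t)) * ?C)\<^sup>2" by (intro power_mono) auto
      also have "\<dots> = ?C\<^sup>2 * exp (- (2 * ?a * t))"
        by (simp add: power_mult_distrib mult.commute mult.left_commute flip: exp_double)
      finally show ?case by (simp add: ennreal_leI flip: ennreal_mult)
    qed
  qed
  also have "\<dots> = ennreal (?C\<^sup>2) * (\<integral>\<^sup>+\<xi>. ennreal (exp (- (2 * damping \<mu> (\<xi> :: real ^ 'n) * t))) \<partial>lborel)"
    unfolding damping_def L_symbol_def by (intro nn_integral_cmult) measurable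
  also have "\<dots> \<le> ennreal (?C\<^sup>2) * ennreal (J / t ^ CARD('n))" by (intro mult_left_mono J) simp
  also have "\<dots> = ennreal (?C\<^sup>2 * (J / t ^ CARD('n)))" by (rule ennreal_mult[symmetric]) (use J t in auto)
  finally have "(L2_norm w)\<^sup>2 \<le> ?C\<^sup>2 * (J / t ^ CARD('n))"
    using J t by (subst (asm) ennreal_le_iff) auto
  then have "L2_norm w \<le> sqrt (?C\<^sup>2 * (J / t ^ CARD('n)))" by (rule real_le_rsqrt)
  also have "\<dots> = sqrt (J / t ^ CARD('n)) * ?C" using C by (simp only: real_sqrt_mult real_sqrt_abs) (simp add: mult.commute)
  finally show ?thesis .
qed

text \<open>On the ball of radius \<open>1 / t\<close> the wave has not completed an oscillation and the damping has lost at
  most a factor \<open>exp (-1)\<close>. There \<open>cmod (w \<xi>)\<close> is at least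
  \<open>exp (-1) * (cmod P * t / 2 - B)\<close>, and the assumption on \<open>B\<close> leaves half of the main term.\<close>
lemma L2_norm_fourier_lower:
  fixes w :: "real ^ 'n::finite \<Rightarrow> complex"
  assumes \<mu>: "0 < \<mu>" "\<mu> < 2" and w: "w \<in> L2_space" and t: "0 < t" and B: "4 * B \<le> cmod P * t"
    and prof: "AE \<xi> in lborel. 0 < norm \<xi> \<and> (\<exists>R. cmod R \<le> B \<and>
       w \<xi> = complex_of_real (exp (- (damping \<mu> \<xi> * t))) *
         (complex_of_real (sin (frequency \<mu> \<xi> * t) / frequency \<mu> \<xi>) * P + R))"
  shows "sqrt (unit_ball_vol (real CARD('n)) / t ^ CARD('n)) * (exp (-1) / 4 * cmod P * t) \<le> L2_norm w"
proof -
  let ?c = "exp (-1) / 4 * cmod P * t"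
  let ?V = "unit_ball_vol (real CARD('n)) / t ^ CARD('n)"
  have c: "0 \<le> ?c" using t by simp
  have V: "emeasure lborel (cball (0 :: real ^ 'n) (1 / t)) = ennreal ?V"
    using t by (subst emeasure_cball) (auto simp: power_one_over)
  have "ennreal (?c\<^sup>2 * ?V) = ennreal (?c\<^sup>2) * emeasure lborel (cball (0 :: real ^ 'n) (1 / t))"
    unfolding V by (rule ennreal_mult) (use t in auto)
  also have "\<dots> = (\<integral>\<^sup>+\<xi>. ennreal (?c\<^sup>2) * indicator (cball (0 :: real ^ 'n) (1 / t)) \<xi> \<partial>lborel)"
    by (rule nn_integral_cmult_indicator[symmetric]) simp
  also have "\<dots> \<le> (\<integral>\<^sup>+\<xi>. ennreal ((cmod (w \<xi>))\<^sup>2) \<partial>lborel)"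
  proof (rule nn_integral_mono_AE)
    show "AE \<xi> in lborel. ennreal (?c\<^sup>2) * indicator (cball (0 :: real ^ 'n) (1 / t)) \<xi> \<le> ennreal ((cmod (w \<xi>))\<^sup>2)"
      using prof
    proof eventually_elim
      case (elim \<xi>)
      let ?a = "damping \<mu> \<xi>" and ?b = "frequency \<mu> \<xi>"
      obtain R where R: "cmod R \<le> B"
        and weq: "w \<xi> = complex_of_real (exp (- (?a * t))) * (complex_of_real (sin (?b * t) / ?b) * P + R)"
        using elim by blast
      show ?case
      proof (cases "norm \<xi> \<le> 1 / t")
        case True
        then have rt: "norm \<xi> * t \<le> 1" using t by (simp add: field_simps)
        have r: "0 < norm \<xi>" using elim by blast
        have "0 < sqrt (1 - (\<mu> / 2)\<^sup>2) * norm \<xi>"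
          using damping_ratio_pos[OF \<mu>] r by (intro mult_pos_pos) auto
        then have b: "0 < ?b" using frequency_bounds(1)[OF \<mu>, of \<xi>] by linarith
        have bt: "?b * t \<le> 1"
          using mult_right_mono[OF frequency_bounds(2)[OF \<mu>, of \<xi>], of t] t rt by linarith
        have s: "t / 2 \<le> sin (?b * t) / ?b"
          using sin_ge_half[of "?b * t"] b t bt by (simp add: field_simps)
        have at: "?a * t \<le> 1"
        proof -
          have "\<mu> / 2 * norm \<xi> \<le> 1 * norm \<xi>" using \<mu> by (intro mult_right_mono) auto
          then have "?a * t \<le> norm \<xi> * t" using damping_bounds(2)[OF \<mu>(1), of \<xi>] t by (intro mult_right_mono) auto
          then show ?thesis using rt by linarith
        qed
        have "t / 2 * cmod P \<le> cmod (complex_of_real (sin (?b * t) / ?b) * P)"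
          unfolding norm_mult norm_of_real by (intro mult_right_mono order_trans[OF s abs_ge_self]) simp
        then have "cmod P * t / 4 \<le> cmod (complex_of_real (sin (?b * t) / ?b) * P) - cmod R"
          using R B by (simp add: mult.commute)
        also have "\<dots> \<le> cmod (complex_of_real (sin (?b * t) / ?b) * P + R)" by (rule norm_diff_ineq)
        finally have "exp (-1) * (cmod P * t / 4) \<le> cmod (w \<xi>)"
          unfolding weq norm_mult norm_of_real using at t by (intro mult_mono) auto
        then have "?c\<^sup>2 \<le> (cmod (w \<xi>))\<^sup>2" using c by (intro power_mono) auto
        then show ?thesis using True by (simp add: ennreal_leI)
      qed simp
    qed
  qed
  also have "\<dots> = ennreal ((L2_norm w)\<^sup>2)" using L2_ennorm2_eq[OF w] by (simp add: L2_ennorm2_def L2_norm_power2)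
  finally have "?c\<^sup>2 * ?V \<le> (L2_norm w)\<^sup>2" by (subst (asm) ennreal_le_iff) auto
  then have "sqrt (?c\<^sup>2 * ?V) \<le> sqrt ((L2_norm w)\<^sup>2)" by (rule real_sqrt_le_mono)
  moreover have "sqrt (?c\<^sup>2 * ?V) = sqrt ?V * ?c" using c by (simp only: real_sqrt_mult real_sqrt_abs) (simp add: mult.commute)
  ultimately show ?thesis by (simp add: L2_norm_nonneg)
qed

theorem theorem1p2:
  fixes \<mu> :: real
  assumes "0 < \<mu>" and "\<mu> < 2"
  shows "\<exists>C1 C2 \<alpha>. C1 > 0 \<and> C2 > 0 \<and> \<alpha> > 0 \<and>
    (\<forall>(u0 :: real ^ 'n::finite \<Rightarrow> complex) (u1 :: real ^ 'n \<Rightarrow> complex) P1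
        (u :: real \<Rightarrow> real ^ 'n \<Rightarrow> complex).
      u0 \<in> H1_space \<inter> L1_space \<longrightarrow>
      u1 \<in> L2_space \<inter> L11_space \<longrightarrow>
      P1 = (\<integral>x. u1 x \<partial>lborel) \<longrightarrow>
      mild_solution \<mu> u0 u1 u \<longrightarrow>
      (\<exists>t0>0. \<forall>t\<ge>t0.
         C1 * cmod P1 * t powr (1 - real CARD('n) / 2) \<le> L2_norm (u t) \<and>
         L2_norm (u t) \<le>
           C2 * (L11_norm u1 * t powr (- (real CARD('n) / 2))
               + L1_norm u0 * t powr (- (real CARD('n) / 2))
               + cmod P1 * t powr (1 - real CARD('n) / 2)
               + cmod P1 * exp (- \<alpha> * t))))"
proof -
  let ?N = "CARD('n)"
  define K where "K = 1 + 1 / sqrt (1 - (\<mu> / 2)\<^sup>2)"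
  have K: "1 \<le> K" using damping_ratio_pos[OF assms] by (simp add: K_def)
  obtain J where J: "0 \<le> J" and Jle: "\<And>t. 2 * real ?N / \<mu> \<le> t \<Longrightarrow>
      (\<integral>\<^sup>+\<xi>. ennreal (exp (- (2 * damping \<mu> (\<xi> :: real ^ 'n) * t))) \<partial>lborel) \<le> ennreal (J / t ^ ?N)"
    using nn_integral_damping_le[OF assms(1), where 'n = 'n] by blast
  define q where "q = sqrt ((2 * pi) ^ ?N)"
  have q: "0 < q" by (simp add: q_def)
  define V where "V = unit_ball_vol (real ?N)"
  have V: "0 < V" by (simp add: V_def)
  define C1 where "C1 = sqrt V * (exp (-1) / 4) / q"
  define C2 where "C2 = (sqrt J + 1) * K / q"
  have C: "0 < C1" "0 < C2" using V q J K by (auto simp: C1_def C2_def add_nonneg_pos)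
  show ?thesis
  \<comment> \<open>The estimate holds with any positive \<open>\<alpha>\<close>.\<close>
  proof (rule exI[of _ C1], rule exI[of _ C2], rule exI[of _ 1], intro conjI allI impI)
    show "0 < C1" "0 < C2" "(0::real) < 1" using C by auto
    fix u0 u1 :: "real ^ 'n \<Rightarrow> complex" and P1 and u :: "real \<Rightarrow> real ^ 'n \<Rightarrow> complex"
    assume u0: "u0 \<in> H1_space \<inter> L1_space" and u1: "u1 \<in> L2_space \<inter> L11_space"
      and P1: "P1 = (\<integral>x. u1 x \<partial>lborel)" and u: "mild_solution \<mu> u0 u1 u"
    define M where "M = L1_norm u0 + L11_norm u1"
    have norms: "0 \<le> L1_norm u0" "0 \<le> L11_norm u1" by (auto simp: L1_norm_def L11_norm_def)
    then have M: "0 \<le> M" by (simp add: M_def)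
    have "u0 \<in> L1_space" "u1 \<in> L11_space" "fourier_equation \<mu> u0 u1 u"
      using u0 u1 u by (auto simp: mild_solution_def)
    from fourier_solution_profile[OF assms this, folded K_def M_def P1]
    obtain w where w: "\<And>t. t \<ge> 0 \<Longrightarrow> has_fourier_L2 (u t) (w t)"
      and prof: "AE \<xi> in lborel. 0 < norm \<xi> \<and> (\<forall>t\<ge>0. \<exists>R. cmod R \<le> K * M \<and>
       w t \<xi> = complex_of_real (exp (- (damping \<mu> \<xi> * t))) *
         (complex_of_real (sin (frequency \<mu> \<xi> * t) / frequency \<mu> \<xi>) * P1 + R))"
      by blast
    \<comment> \<open>Beyond the first entry the decay of \<open>nn_integral_damping_le\<close> holds; the second makes the term with
      \<open>P1\<close> dominate the remainder, and is \<open>0\<close> if \<open>P1 = 0\<close>, when the lower bound is trivial.\<close>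
    define t0 where "t0 = max (2 * real ?N / \<mu>) (4 * (K * M) / cmod P1)"
    have t00: "0 < t0" using assms(1) by (simp add: t0_def less_max_iff_disj)
    have "C1 * cmod P1 * t powr (1 - real ?N / 2) \<le> L2_norm (u t) \<and>
         L2_norm (u t) \<le>
           C2 * (L11_norm u1 * t powr (- (real ?N / 2))
               + L1_norm u0 * t powr (- (real ?N / 2))
               + cmod P1 * t powr (1 - real ?N / 2)
               + cmod P1 * exp (- 1 * t))" if tt: "t0 \<le> t" for t
    proof -
      have t: "0 < t" using t00 tt by linarith
      have tN: "2 * real ?N / \<mu> \<le> t" and tP: "4 * (K * M) / cmod P1 \<le> t"
        using tt by (auto simp: t0_def)
      \<comment> \<open>Both powers of \<open>t\<close> are expressed through \<open>D\<close>, the square root of the Jacobian \<open>t powr (- n)\<close>.\<close>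
      define D where "D = t powr (- (real ?N / 2))"
      have D: "0 < D" using t by (simp add: D_def)
      have D1: "t powr (1 - real ?N / 2) = t * D"
        using t powr_add[of t 1 "- (real ?N / 2)"] by (simp add: D_def)
      have sqrtD: "sqrt (x / t ^ ?N) = sqrt x * D" for x
      proof -
        have "sqrt (t ^ ?N) = (t powr real ?N) powr (1 / 2)"
          unfolding powr_realpow[OF t] using t by (intro powr_half_sqrt[symmetric]) simp
        also have "\<dots> = t powr (real ?N / 2)" by (simp only: powr_powr) simp
        finally have "D = inverse (sqrt (t ^ ?N))" by (simp add: D_def powr_minus)
        then show ?thesis by (simp only: real_sqrt_divide divide_inverse[of "sqrt x"])
      qed
      have wt: "has_fourier_L2 (u t) (w t)" using w t by simp
      then have wL2: "w t \<in> L2_space" by (simp add: has_fourier_L2_def)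
      have "L2_norm (w t) = sqrt ((L2_norm (w t))\<^sup>2)" by (simp add: L2_norm_nonneg)
      also have "\<dots> = q * L2_norm (u t)"
        unfolding has_fourier_L2_plancherel[OF wt] q_def by (simp add: real_sqrt_mult L2_norm_nonneg)
      finally have pl: "L2_norm (u t) = L2_norm (w t) / q" using q by simp
      have prof_t: "AE \<xi> in lborel. 0 < norm \<xi> \<and> (\<exists>R. cmod R \<le> K * M \<and>
         w t \<xi> = complex_of_real (exp (- (damping \<mu> \<xi> * t))) *
         (complex_of_real (sin (frequency \<mu> \<xi> * t) / frequency \<mu> \<xi>) * P1 + R))"
        using prof
      proof eventually_elim
        case (elim \<xi>)
        show ?case
          using conjunct1[OF elim] conjunct2[OF elim, THEN spec, THEN mp, OF less_imp_le[OF t]] by (rule conjI)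
      qed
      have "C1 * cmod P1 * t powr (1 - real ?N / 2) \<le> L2_norm (u t)"
      proof (cases "P1 = 0")
        case False
        then have "4 * (K * M) \<le> cmod P1 * t" using tP by (simp add: field_simps)
        from L2_norm_fourier_lower[OF assms wL2 t this prof_t]
        have "sqrt V * D * (exp (-1) / 4 * cmod P1 * t) \<le> L2_norm (w t)" by (simp add: sqrtD V_def)
        then have "sqrt V * D * (exp (-1) / 4 * cmod P1 * t) / q \<le> L2_norm (u t)"
          unfolding pl using q by (intro divide_right_mono) auto
        then show ?thesis unfolding D1 C1_def by (simp add: mult_ac)
      qed (simp add: L2_norm_nonneg)
      moreover have "L2_norm (u t) \<le> C2 * (L11_norm u1 * D + L1_norm u0 * D + cmod P1 * (t * D) + cmod P1 * exp (- 1 * t))"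
      proof -
        have "L2_norm (w t) \<le> sqrt J * D * (cmod P1 * t + K * M)"
          using L2_norm_fourier_upper[OF assms wL2 t _ J Jle[OF tN] prof_t] K M by (simp add: sqrtD)
        also have "\<dots> \<le> (sqrt J + 1) * D * (K * (cmod P1 * t) + K * M)"
        proof (rule mult_mono)
          show "sqrt J * D \<le> (sqrt J + 1) * D" using D by (intro mult_right_mono) auto
          show "cmod P1 * t + K * M \<le> K * (cmod P1 * t) + K * M"
            using mult_right_mono[OF K, of "cmod P1 * t"] t by simp
        qed (use J D K M t in auto)
        also have "\<dots> = (sqrt J + 1) * K * (L11_norm u1 * D + L1_norm u0 * D + cmod P1 * (t * D))"
          by (simp add: M_def algebra_simps)
        also have "\<dots> \<le> (sqrt J + 1) * K * (L11_norm u1 * D + L1_norm u0 * D + cmod P1 * (t * D) + cmod P1 * exp (- 1 * t))"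
          using J K by (intro mult_left_mono) auto
        finally show ?thesis unfolding pl C2_def using q by (simp add: field_simps)
      qed
      ultimately show ?thesis unfolding D1 D_def[symmetric] by blast
    qed
    then show "\<exists>t0>0. \<forall>t\<ge>t0. C1 * cmod P1 * t powr (1 - real ?N / 2) \<le> L2_norm (u t) \<and>
         L2_norm (u t) \<le>
           C2 * (L11_norm u1 * t powr (- (real ?N / 2))
               + L1_norm u0 * t powr (- (real ?N / 2))
               + cmod P1 * t powr (1 - real ?N / 2)
               + cmod P1 * exp (- 1 * t))"
      using t00 by blast
  qed
qed

end
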